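(* Let $N\ge2$, $p,q>1$ and $f,g\in L^1(\partial B_2)$, where $\partial B_2=\{x\in\mathbb{R}^N:|x|=2\}$. Suppose that $$\int_{\partial B_2}f(x)\,d\sigma>0,\qquad \int_{\partial B_2}g(x)\,d\sigma>0,$$ and $$\rho=\begin{cases}1+\dfrac{p(q+1)}{p+1}&\text{if }p\ge q,\\[2mm] 1+\dfrac{q(p+1)}{q+1}&\text{if }p<q.\end{cases}$$ Let $A=\{x\in\mathbb{R}^N:1<|x|\le2\}$. Then: (i) the parabolic system $$u_t-\Delta u\ge(|x|-1)^{-\rho}|v|^q,\qquad v_t-\Delta v\ge(|x|-1)^{-\rho}|u|^p\qquad\text{in }(0,\infty)\times A,$$ with either the Neumann-type boundary conditions $\frac{\partial u}{\partial\nu}(t,x)\ge f(x)$, $\frac{\partial v}{\partial\nu}(t,x)\ge g(x)$ on $(0,\infty)\times\partial B_2$, or the Dirichlet-type boundary conditions $u(t,x)\ge f(x)$, $v(t,x)\ge g(x)$ on $(0,\infty)\times\partial B_2$, admits no global in time weak solutions; (ii) the hyperbolic system $$u_{tt}-\Delta u\ge(|x|-1)^{-\rho}|v|^q,\qquad v_{tt}-\Delta v\ge(|x|-1)^{-\rho}|u|^p\qquad\text{in }(0,\infty)\times A,$$ with either the Neumann-type boundary conditions $\frac{\partial u}{\partial\nu}(t,x)\ge f(x)$, $\frac{\partial v}{\partial\nu}(t,x)\ge g(x)$ on $(0,\infty)\times\partial B_2$, or the Dirichlet-type boundary conditions $u(t,x)\ge f(x)$, $v(t,x)\ge g(x)$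 on $(0,\infty)\times\partial B_2$, admits no global in time weak solutions.
   Context: Notation: $A=\{x\in\mathbb{R}^N:1<|x|\le2\}$ (the outer sphere $|x|=2$ belongs to $A$, the inner sphere $|x|=1$ does not); for $T\in(0,\infty]$, $Q_T=(0,T)\times A$ and $\Gamma=(0,T)\times\partial B_2$; $\nu$ is the outward unit normal on $\partial B_2$ relative to $A$; $d\sigma$ is the surface measure on $\partial B_2$. $L^p_{\rm loc}(Q_T)$ and $C^2_c(Q_T)$ refer to compact subsets of $Q_T$; these may touch $|x|=2$ but not $|x|=1$. No initial conditions are imposed. Test functions. Neumann class: all $\varphi\in C^2_c(Q_T)$ with $\varphi\ge0$, $\varphi(T,\cdot)=0$ (automatic from compact support when $T=\infty$) and $\frac{\partial\varphi}{\partial\nu}=0$ on $\Gamma$. Dirichlet class: all $\psi\in C^2_c(Q_T)$ with $\psi\ge0$, $\psi(T,\cdot)=0$ (automatic when $T=\infty$), $\psi=0$ on $\Gamma$ and $\frac{\partial\psi}{\partial\nu}\le0$ on $\Gamma$. Weak solutions. A pair $(u,v)\in L^p_{\rm loc}(Q_T)\times L^q_{\rm loc}(Q_T)$ is a weak solution of: - the parabolic Neumann problem if, for all $\varphi$ in the Neumann class, $$\int_{Q_T}(|x|-1)^{-\rho}|u|^p\varphi\,dx\,dt+\int_\Gamma g\varphi\,d\sigma\,dt\le-\int_{Q_T}v\varphi_t\,dx\,dt-\int_{Q_T}v\Delta\varphi\,dx\,dt,$$ $$\int_{Q_T}(|x|-1)^{-\rho}|v|^q\varphi\,dx\,dt+\int_\Gamma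 f\varphi\,d\sigma\,dt\le-\int_{Q_T}u\varphi_t\,dx\,dt-\int_{Q_T}u\Delta\varphi\,dx\,dt;$$ - the parabolic Dirichlet problem if, for all $\psi$ in the Dirichlet class, $$\int_{Q_T}(|x|-1)^{-\rho}|u|^p\psi\,dx\,dt-\int_\Gamma g\frac{\partial\psi}{\partial\nu}\,d\sigma\,dt\le-\int_{Q_T}v\psi_t\,dx\,dt-\int_{Q_T}v\Delta\psi\,dx\,dt,$$ $$\int_{Q_T}(|x|-1)^{-\rho}|v|^q\psi\,dx\,dt-\int_\Gamma f\frac{\partial\psi}{\partial\nu}\,d\sigma\,dt\le-\int_{Q_T}u\psi_t\,dx\,dt-\int_{Q_T}u\Delta\psi\,dx\,dt;$$ - the hyperbolic Neumann problem if, for all $\varphi$ in the Neumann class, $$\int_{Q_T}(|x|-1)^{-\rho}|u|^p\varphi\,dx\,dt+\int_\Gamma g\varphi\,d\sigma\,dt\le\int_{Q_T}v\varphi_{tt}\,dx\,dt-\int_{Q_T}v\Delta\varphi\,dx\,dt,$$ $$\int_{Q_T}(|x|-1)^{-\rho}|v|^q\varphi\,dx\,dt+\int_\Gamma f\varphi\,d\sigma\,dt\le\int_{Q_T}u\varphi_{tt}\,dx\,dt-\int_{Q_T}u\Delta\varphi\,dx\,dt;$$ - the hyperbolic Dirichlet problem if, for all $\psi$ in the Dirichlet class, $$\int_{Q_T}(|x|-1)^{-\rho}|u|^p\psi\,dx\,dt-\int_\Gamma g\frac{\partial\psi}{\partial\nu}\,d\sigma\,dt\le\int_{Q_T}v\psi_{tt}\,dx\,dt-\int_{Q_T}v\Delta\psi\,dx\,dt,$$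 $$\int_{Q_T}(|x|-1)^{-\rho}|v|^q\psi\,dx\,dt-\int_\Gamma f\frac{\partial\psi}{\partial\nu}\,d\sigma\,dt\le\int_{Q_T}u\psi_{tt}\,dx\,dt-\int_{Q_T}u\Delta\psi\,dx\,dt.$$ A weak solution is called global (in time) if $T=+\infty$. *)

theory Defs
  imports "HOL-Analysis.Analysis"
begin

section \<open>Surface measure on spheres\<close>

text \<open>
  The surface measure of the sphere of radius \<open>r\<close> about the origin is introduced by the usual cone
  construction: a Borel subset \<open>E\<close> of the sphere has surface measure \<open>N r\<^sup>N\<^sup>-\<^sup>1\<close> times the Lebesgue
  measure of the part of the unit ball lying in the cone over \<open>E\<close>. It is a Borel measure on the
  whole space that is concentrated on the sphere (see \<open>emeasure_sphere_measure_Compl\<close> and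
  \<open>measure_sphere_measure_total\<close>).
\<close>

definition sphere_measure :: "real \<Rightarrow> 'a::euclidean_space measure" where
  "sphere_measure r =
     scale_measure (ennreal (real DIM('a) * r ^ (DIM('a) - 1)))
       (distr (restrict_space lborel (ball 0 1)) borel (\<lambda>x. r *\<^sub>R sgn x))"

lemma sgn_scale_measurable:
  "(\<lambda>x::'a::euclidean_space. r *\<^sub>R sgn x) \<in> borel_measurable borel"
  unfolding sgn_div_norm by measurable

lemma sets_sphere_measure [simp, measurable_cong]: "sets (sphere_measure r) = sets borel"
  and space_sphere_measure [simp]: "space (sphere_measure r) = UNIV"
  by (simp_all add: sphere_measure_def space_scale_measure)

lemma emeasure_sphere_measure:
  assumes "E \<in> sets borel"
  shows "emeasure (sphere_measure r :: 'a::euclidean_space measure) E =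
    ennreal (real DIM('a) * r ^ (DIM('a) - 1)) * emeasure lborel {x \<in> ball 0 1. r *\<^sub>R sgn x \<in> E}"
proof -
  have m: "(\<lambda>x::'a. r *\<^sub>R sgn x) \<in> restrict_space lborel (ball 0 1) \<rightarrow>\<^sub>M borel"
    using sgn_scale_measurable[of r] by (intro measurable_restrict_space1) simp
  have "(\<lambda>x::'a. r *\<^sub>R sgn x) -` E \<inter> ball 0 1 = {x \<in> ball 0 1. r *\<^sub>R sgn x \<in> E}"
    by auto
  then have "emeasure (distr (restrict_space lborel (ball 0 1)) borel (\<lambda>x::'a. r *\<^sub>R sgn x)) E =
      emeasure (restrict_space lborel (ball 0 1)) {x \<in> ball 0 1. r *\<^sub>R sgn x \<in> E}"
    using assms m by (simp add: emeasure_distr space_restrict_space)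
  also have "\<dots> = emeasure lborel {x \<in> ball 0 1. r *\<^sub>R sgn x \<in> E}"
    by (rule emeasure_restrict_space) auto
  finally show ?thesis by (simp add: sphere_measure_def)
qed

lemma emeasure_sphere_measure_Compl:
  assumes "r \<ge> 0"
  shows "emeasure (sphere_measure r) (- sphere (0::'a::euclidean_space) r) = 0"
proof -
  have "{x \<in> ball 0 1. r *\<^sub>R sgn x \<in> - sphere (0::'a) r} \<subseteq> {0}"
    using assms by (auto simp: norm_sgn split: if_splits)
  then have "emeasure lborel {x \<in> ball 0 1. r *\<^sub>R sgn x \<in> - sphere (0::'a) r} \<le> emeasure lborel {0::'a}"
    by (intro emeasure_mono) auto
  then show ?thesis by (subst emeasure_sphere_measure) (auto simp: borel_open)
qed

lemma finite_measure_sphere_measure: "finite_measure (sphere_measure r :: 'a::euclidean_space measure)"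
proof
  have "emeasure lborel (ball (0::'a) 1) < \<infinity>" by (intro emeasure_bounded_finite) auto
  moreover have "{x \<in> ball 0 1. r *\<^sub>R sgn x \<in> UNIV} = ball (0::'a) 1" by auto
  ultimately show "emeasure (sphere_measure r :: 'a measure) (space (sphere_measure r)) \<noteq> \<infinity>"
    by (auto simp: emeasure_sphere_measure ennreal_mult_eq_top_iff)
qed

lemma measure_sphere_measure_total:
  assumes "r \<ge> 0"
  shows "measure (sphere_measure r :: 'a::euclidean_space measure) UNIV =
    real DIM('a) * r ^ (DIM('a) - 1) * unit_ball_vol (real DIM('a))"
proof -
  have "{x \<in> ball 0 1. r *\<^sub>R sgn x \<in> UNIV} = ball (0::'a) 1" by auto
  then have "emeasure (sphere_measure r :: 'a measure) UNIV =
      ennreal (real DIM('a) * r ^ (DIM('a) - 1)) * ennreal (unit_ball_vol (real DIM('a)))"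
    by (simp add: emeasure_sphere_measure emeasure_ball)
  then show ?thesis
    using assms by (simp add: measure_def enn2real_mult)
qed

section \<open>Domains\<close>

text \<open>The time horizon \<open>T\<close> ranges over the extended reals, \<open>T = \<infinity>\<close> being the global case.\<close>

definition shell :: "'a::euclidean_space set" where
  "shell = {x. 1 < norm x \<and> norm x \<le> 2}"

definition Q_dom :: "ereal \<Rightarrow> (real \<times> 'a::euclidean_space) set" where
  "Q_dom T = {t. 0 < t \<and> ereal t < T} \<times> shell"

definition Gamma_dom :: "ereal \<Rightarrow> (real \<times> 'a::euclidean_space) set" where
  "Gamma_dom T = {t. 0 < t \<and> ereal t < T} \<times> sphere 0 2"

definition Lp_loc :: "real \<Rightarrow> 'b::euclidean_space set \<Rightarrow> ('b \<Rightarrow> real) \<Rightarrow> bool" where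
  "Lp_loc p S u \<longleftrightarrow> (\<forall>K. compact K \<and> K \<subseteq> S \<longrightarrow>
     set_borel_measurable lebesgue K u \<and> set_integrable lebesgue K (\<lambda>z. \<bar>u z\<bar> powr p))"

section \<open>Test functions\<close>

text \<open>
  A function is \<open>C\<^sup>2\<close> on a set that need not be open if it is twice continuously differentiable on
  some open neighbourhood of it. Since \<open>Q_dom T\<close> contains its lateral boundary \<open>norm x = 2\<close>, this
  means regularity up to that boundary; the values outside \<open>Q_dom T\<close> are otherwise irrelevant, as the
  derivatives at boundary points are determined by the values inside.
\<close>

definition C2_on :: "'b::real_normed_vector set \<Rightarrow> ('b \<Rightarrow> real) \<Rightarrow> bool" where
  "C2_on S \<phi> \<longleftrightarrow>
     (\<exists>U (\<phi>' :: 'b \<Rightarrow> 'b \<Rightarrow>\<^sub>L real) (\<phi>'' :: 'b \<Rightarrow> 'b \<Rightarrow>\<^sub>L 'b \<Rightarrow>\<^sub>L real).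
        open U \<and> S \<subseteq> U \<and>
        (\<forall>z\<in>U. (\<phi> has_derivative blinfun_apply (\<phi>' z)) (at z)) \<and>
        (\<forall>z\<in>U. (\<phi>' has_derivative blinfun_apply (\<phi>'' z)) (at z)) \<and>
        continuous_on U \<phi>'')"

definition C2c :: "'b::real_normed_vector set \<Rightarrow> ('b \<Rightarrow> real) \<Rightarrow> bool" where
  "C2c S \<phi> \<longleftrightarrow> C2_on S \<phi> \<and> (\<exists>K. compact K \<and> K \<subseteq> S \<and> (\<forall>z\<in>S - K. \<phi> z = 0))"

definition time_deriv :: "(real \<times> 'a \<Rightarrow> real) \<Rightarrow> real \<times> 'a \<Rightarrow> real" where
  "time_deriv \<phi> = (\<lambda>(t, x). deriv (\<lambda>s. \<phi> (s, x)) t)"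

definition time_deriv2 :: "(real \<times> 'a \<Rightarrow> real) \<Rightarrow> real \<times> 'a \<Rightarrow> real" where
  "time_deriv2 \<phi> = (\<lambda>(t, x). (deriv ^^ 2) (\<lambda>s. \<phi> (s, x)) t)"

definition laplacian :: "(real \<times> 'a::euclidean_space \<Rightarrow> real) \<Rightarrow> real \<times> 'a \<Rightarrow> real" where
  "laplacian \<phi> = (\<lambda>(t, x). \<Sum>b\<in>Basis. (deriv ^^ 2) (\<lambda>h. \<phi> (t, x + h *\<^sub>R b)) 0)"

text \<open>At a point \<open>x\<close> of the outer sphere the outward unit normal relative to the shell is \<open>sgn x\<close>.\<close>

definition normal_deriv :: "(real \<times> 'a::euclidean_space \<Rightarrow> real) \<Rightarrow> real \<times> 'a \<Rightarrow> real" where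
  "normal_deriv \<phi> = (\<lambda>(t, x). deriv (\<lambda>h. \<phi> (t, x + h *\<^sub>R sgn x)) 0)"

definition test_function :: "ereal \<Rightarrow> (real \<times> 'a::euclidean_space \<Rightarrow> real) \<Rightarrow> bool" where
  "test_function T \<phi> \<longleftrightarrow>
     C2c (Q_dom T) \<phi> \<and> (\<forall>z\<in>Q_dom T. \<phi> z \<ge> 0) \<and>
     (\<forall>t. T = ereal t \<longrightarrow> (\<forall>x\<in>shell. \<phi> (t, x) = 0))"

definition neumann_test :: "ereal \<Rightarrow> (real \<times> 'a::euclidean_space \<Rightarrow> real) \<Rightarrow> bool" where
  "neumann_test T \<phi> \<longleftrightarrow> test_function T \<phi> \<and> (\<forall>z\<in>Gamma_dom T. normal_deriv \<phi> z = 0)"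

definition dirichlet_test :: "ereal \<Rightarrow> (real \<times> 'a::euclidean_space \<Rightarrow> real) \<Rightarrow> bool" where
  "dirichlet_test T \<psi> \<longleftrightarrow>
     test_function T \<psi> \<and> (\<forall>z\<in>Gamma_dom T. \<psi> z = 0 \<and> normal_deriv \<psi> z \<le> 0)"

section \<open>Weak solutions\<close>

definition int_Q :: "ereal \<Rightarrow> (real \<times> 'a::euclidean_space \<Rightarrow> real) \<Rightarrow> real" where
  "int_Q T F = (LINT z:Q_dom T|lebesgue. F z)"

definition int_Gamma :: "ereal \<Rightarrow> (real \<times> 'a::euclidean_space \<Rightarrow> real) \<Rightarrow> real" where
  "int_Gamma T F = (LINT z:Gamma_dom T|(lborel \<Otimes>\<^sub>M sphere_measure 2). F z)"

definition weight :: "real \<Rightarrow> real \<times> 'a::euclidean_space \<Rightarrow> real" where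
  "weight \<rho> = (\<lambda>(t, x). (norm x - 1) powr (- \<rho>))"

definition parabolic_neumann_solution ::
  "ereal \<Rightarrow> real \<Rightarrow> real \<Rightarrow> real \<Rightarrow> ('a::euclidean_space \<Rightarrow> real) \<Rightarrow> ('a \<Rightarrow> real) \<Rightarrow>
   (real \<times> 'a \<Rightarrow> real) \<Rightarrow> (real \<times> 'a \<Rightarrow> real) \<Rightarrow> bool" where
  "parabolic_neumann_solution T p q \<rho> f g u v \<longleftrightarrow>
     Lp_loc p (Q_dom T) u \<and> Lp_loc q (Q_dom T) v \<and>
     (\<forall>\<phi>. neumann_test T \<phi> \<longrightarrow>
        int_Q T (\<lambda>z. weight \<rho> z * \<bar>u z\<bar> powr p * \<phi> z) + int_Gamma T (\<lambda>z. g (snd z) * \<phi> z)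
          \<le> - int_Q T (\<lambda>z. v z * time_deriv \<phi> z) - int_Q T (\<lambda>z. v z * laplacian \<phi> z) \<and>
        int_Q T (\<lambda>z. weight \<rho> z * \<bar>v z\<bar> powr q * \<phi> z) + int_Gamma T (\<lambda>z. f (snd z) * \<phi> z)
          \<le> - int_Q T (\<lambda>z. u z * time_deriv \<phi> z) - int_Q T (\<lambda>z. u z * laplacian \<phi> z))"

definition parabolic_dirichlet_solution ::
  "ereal \<Rightarrow> real \<Rightarrow> real \<Rightarrow> real \<Rightarrow> ('a::euclidean_space \<Rightarrow> real) \<Rightarrow> ('a \<Rightarrow> real) \<Rightarrow>
   (real \<times> 'a \<Rightarrow> real) \<Rightarrow> (real \<times> 'a \<Rightarrow> real) \<Rightarrow> bool" where
  "parabolic_dirichlet_solution T p q \<rho> f g u v \<longleftrightarrow>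
     Lp_loc p (Q_dom T) u \<and> Lp_loc q (Q_dom T) v \<and>
     (\<forall>\<psi>. dirichlet_test T \<psi> \<longrightarrow>
        int_Q T (\<lambda>z. weight \<rho> z * \<bar>u z\<bar> powr p * \<psi> z) - int_Gamma T (\<lambda>z. g (snd z) * normal_deriv \<psi> z)
          \<le> - int_Q T (\<lambda>z. v z * time_deriv \<psi> z) - int_Q T (\<lambda>z. v z * laplacian \<psi> z) \<and>
        int_Q T (\<lambda>z. weight \<rho> z * \<bar>v z\<bar> powr q * \<psi> z) - int_Gamma T (\<lambda>z. f (snd z) * normal_deriv \<psi> z)
          \<le> - int_Q T (\<lambda>z. u z * time_deriv \<psi> z) - int_Q T (\<lambda>z. u z * laplacian \<psi> z))"

definition hyperbolic_neumann_solution ::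
  "ereal \<Rightarrow> real \<Rightarrow> real \<Rightarrow> real \<Rightarrow> ('a::euclidean_space \<Rightarrow> real) \<Rightarrow> ('a \<Rightarrow> real) \<Rightarrow>
   (real \<times> 'a \<Rightarrow> real) \<Rightarrow> (real \<times> 'a \<Rightarrow> real) \<Rightarrow> bool" where
  "hyperbolic_neumann_solution T p q \<rho> f g u v \<longleftrightarrow>
     Lp_loc p (Q_dom T) u \<and> Lp_loc q (Q_dom T) v \<and>
     (\<forall>\<phi>. neumann_test T \<phi> \<longrightarrow>
        int_Q T (\<lambda>z. weight \<rho> z * \<bar>u z\<bar> powr p * \<phi> z) + int_Gamma T (\<lambda>z. g (snd z) * \<phi> z)
          \<le> int_Q T (\<lambda>z. v z * time_deriv2 \<phi> z) - int_Q T (\<lambda>z. v z * laplacian \<phi> z) \<and>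
        int_Q T (\<lambda>z. weight \<rho> z * \<bar>v z\<bar> powr q * \<phi> z) + int_Gamma T (\<lambda>z. f (snd z) * \<phi> z)
          \<le> int_Q T (\<lambda>z. u z * time_deriv2 \<phi> z) - int_Q T (\<lambda>z. u z * laplacian \<phi> z))"

definition hyperbolic_dirichlet_solution ::
  "ereal \<Rightarrow> real \<Rightarrow> real \<Rightarrow> real \<Rightarrow> ('a::euclidean_space \<Rightarrow> real) \<Rightarrow> ('a \<Rightarrow> real) \<Rightarrow>
   (real \<times> 'a \<Rightarrow> real) \<Rightarrow> (real \<times> 'a \<Rightarrow> real) \<Rightarrow> bool" where
  "hyperbolic_dirichlet_solution T p q \<rho> f g u v \<longleftrightarrow>
     Lp_loc p (Q_dom T) u \<and> Lp_loc q (Q_dom T) v \<and>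
     (\<forall>\<psi>. dirichlet_test T \<psi> \<longrightarrow>
        int_Q T (\<lambda>z. weight \<rho> z * \<bar>u z\<bar> powr p * \<psi> z) - int_Gamma T (\<lambda>z. g (snd z) * normal_deriv \<psi> z)
          \<le> int_Q T (\<lambda>z. v z * time_deriv2 \<psi> z) - int_Q T (\<lambda>z. v z * laplacian \<psi> z) \<and>
        int_Q T (\<lambda>z. weight \<rho> z * \<bar>v z\<bar> powr q * \<psi> z) - int_Gamma T (\<lambda>z. f (snd z) * normal_deriv \<psi> z)
          \<le> int_Q T (\<lambda>z. u z * time_deriv2 \<psi> z) - int_Q T (\<lambda>z. u z * laplacian \<psi> z))"

end

theory Submission
  imports Defs
begin

text \<open>
  The proof is the test function method at the critical exponent. Write \<open>\<tau> = x \<bullet> x\<close>. The weak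
  inequalities are tested with \<open>\<eta> t * H \<tau> * \<xi> \<tau>\<close>, where \<open>\<eta>\<close> is a cutoff on \<open>(T, 2 T)\<close>, \<open>\<xi>\<close> removes
  the neighbourhood \<open>\<tau> \<le> 1 + \<epsilon>\<close> of the singular sphere, and \<open>H\<close> is a radial harmonic function:
  \<open>H = 1\<close> for the Neumann problem, and the one vanishing on the outer sphere for the Dirichlet problem.
  The boundary datum then contributes a positive multiple of \<open>T\<close>. The Laplacian of the test
  function lives in the layer \<open>1 + \<epsilon> < \<tau> < 1 + 2 \<epsilon>\<close> and is of size \<open>1 / \<epsilon>\<^sup>2\<close>, and its time derivatives
  are of size \<open>1 / T\<close> and become negligible when \<open>T\<close> is large compared with every other parameter;
  this is how the parabolic and the hyperbolic problem are treated alike.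

  Let \<open>a\<close> and \<open>b\<close> be the weighted energies of \<open>u\<close> and \<open>v\<close>, divided by \<open>T\<close>. Young's inequality with a free
  parameter gives (\<open>test_estimate\<close>), for \<open>p \<ge> q\<close>, \<open>\<delta> = (p - q) / (p + 1)\<close> and positive constants
  \<open>G\<close>, \<open>F\<close> coming from the boundary data,

    \<open>a + G \<le> l * b + C * l powr (- 1 / (q - 1)) * \<epsilon> powr (\<delta> / (q - 1))\<close>,

    \<open>b + F \<le> l * a + C * l powr (- 1 / (p - 1)) * \<epsilon> powr (- p * \<delta> / (p - 1))\<close>,

  up to terms that vanish as \<open>T\<close> grows. At the critical \<open>\<rho>\<close> the powers of \<open>\<epsilon>\<close> cancel when the two
  are combined, so one only obtains that \<open>a\<close> is bounded uniformly in \<open>\<epsilon>\<close>. The contradiction comes from the layers: on the right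
  of the second inequality only the part of \<open>a\<close> in the layer is needed, and the dyadic layers
  \<open>\<epsilon> = 1/2, 1/4, ...\<close> share one bounded total energy, so some layer carries arbitrarily little of it. For
  that layer the right-hand sides become smaller than \<open>G\<close> (\<open>critical_iteration\<close>).

  Instead of Hoelder's inequality all estimates are pointwise. This works because the cutoffs
  are \<open>m\<close>-th powers with large \<open>m\<close>, so that their derivatives are bounded by the \<open>1 / r\<close>-th power of the
  test function for the exponents \<open>r = p, q\<close>.
\<close>

section \<open>Powers of the positive part and explicit second derivatives\<close>

text \<open>
  The test functions are built from powers \<open>(max 0 x) ^ m\<close>. They vanish on a half-line and, for
  \<open>m \<ge> 3\<close>, are twice continuously differentiable. Their derivatives lose only two powers, which is
  what makes a derivative of a cutoff controllable by a fractional power of the cutoff itself; a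
  smooth bump function with unspecified profile would not give this.
\<close>

definition pospow :: "nat \<Rightarrow> real \<Rightarrow> real" where
  "pospow m x = max 0 x ^ m"

lemma pospow_nonneg [simp]: "0 \<le> pospow m x"
  by (simp add: pospow_def)

lemma pospow_nonpos: "x \<le> 0 \<Longrightarrow> 0 < m \<Longrightarrow> pospow m x = 0"
  by (simp add: pospow_def max_def)

lemma pospow_le_1: "x \<le> 1 \<Longrightarrow> pospow m x \<le> 1"
  by (simp add: pospow_def power_le_one)

lemma pospow_one [simp]: "pospow m 1 = 1"
  by (simp add: pospow_def)

lemma pospow_antimono: "x \<le> 1 \<Longrightarrow> k \<le> m \<Longrightarrow> pospow m x \<le> pospow k x"
  by (simp add: pospow_def power_decreasing)

lemma continuous_on_pospow [continuous_intros]: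
  "continuous_on S f \<Longrightarrow> continuous_on S (\<lambda>x. pospow m (f x))"
  unfolding pospow_def by (intro continuous_intros)

lemma DERIV_pospow:
  assumes "2 \<le> m"
  shows "(pospow m has_real_derivative real m * pospow (m - 1) x) (at x)"
proof -
  consider "x < 0" | "x > 0" | "x = 0" by linarith
  then show ?thesis
  proof cases
    case 1
    have "((\<lambda>x. 0) has_real_derivative 0) (at x)" by simp
    then have "(pospow m has_real_derivative 0) (at x)"
      by (rule has_field_derivative_transform_within_open[of _ _ _ "{..<0}"])
        (use 1 assms in \<open>auto simp: pospow_nonpos\<close>)
    then show ?thesis using 1 assms by (simp add: pospow_nonpos)
  next
    case 2
    have "((\<lambda>x. x ^ m) has_real_derivative real m * x ^ (m - 1)) (at x)"
      by (auto intro!: derivative_eq_intros)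
    then have "(pospow m has_real_derivative real m * x ^ (m - 1)) (at x)"
      by (rule has_field_derivative_transform_within_open[of _ _ _ "{0<..}"])
        (use 2 in \<open>auto simp: pospow_def\<close>)
    then show ?thesis using 2 by (simp add: pospow_def max_def)
  next
    case 3
    have "continuous_on UNIV (\<lambda>h. pospow (m - 1) h)" by (intro continuous_intros)
    then have "isCont (\<lambda>h. pospow (m - 1) h) 0"
      by (simp add: continuous_on_eq_continuous_at)
    then have "((\<lambda>h. pospow (m - 1) h) \<longlongrightarrow> 0) (at 0)"
      using assms by (simp add: isCont_def pospow_nonpos)
    moreover have "(pospow m (0 + h) - pospow m 0) / h = pospow (m - 1) h" if "h \<noteq> 0" for h
      using that assms by (cases "h > 0")
        (auto simp: pospow_nonpos, auto simp: pospow_def power_diff)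
    ultimately have "((\<lambda>h. (pospow m (0 + h) - pospow m 0) / h) \<longlongrightarrow> 0) (at 0)"
      by (subst Lim_cong_within[OF refl refl refl, where g = "pospow (m - 1)"]) auto
    then show ?thesis using 3 assms by (simp add: DERIV_def pospow_nonpos)
  qed
qed

text \<open>
  Carrying the first and second derivative along as explicit functions makes it possible to read off
  the time derivatives and the Laplacian of a test function from its one-dimensional factors.
\<close>

definition C2_triple :: "real set \<Rightarrow> (real \<Rightarrow> real) \<Rightarrow> (real \<Rightarrow> real) \<Rightarrow> (real \<Rightarrow> real) \<Rightarrow> bool" where
  "C2_triple S f f1 f2 \<longleftrightarrow>
     (\<forall>x\<in>S. (f has_real_derivative f1 x) (at x)) \<and>
     (\<forall>x\<in>S. (f1 has_real_derivative f2 x) (at x)) \<and> continuous_on S f2"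

lemma C2_triple_continuous:
  assumes "C2_triple S f f1 f2"
  shows "continuous_on S f" "continuous_on S f1" "continuous_on S f2"
  using assms unfolding C2_triple_def
  by (blast intro: DERIV_isCont continuous_at_imp_continuous_on)+

lemma C2_triple_mult:
  assumes "C2_triple S f f1 f2" "C2_triple S g g1 g2"
  shows "C2_triple S (\<lambda>x. f x * g x) (\<lambda>x. f1 x * g x + f x * g1 x)
    (\<lambda>x. f2 x * g x + 2 * f1 x * g1 x + f x * g2 x)"
  unfolding C2_triple_def
proof (intro conjI ballI)
  fix x assume "x \<in> S"
  then have d: "(f has_real_derivative f1 x) (at x)" "(f1 has_real_derivative f2 x) (at x)"
    "(g has_real_derivative g1 x) (at x)" "(g1 has_real_derivative g2 x) (at x)"
    using assms by (auto simp: C2_triple_def)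
  show "((\<lambda>x. f x * g x) has_real_derivative f1 x * g x + f x * g1 x) (at x)"
    by (rule derivative_eq_intros d refl)+ simp
  show "((\<lambda>x. f1 x * g x + f x * g1 x) has_real_derivative
      f2 x * g x + 2 * f1 x * g1 x + f x * g2 x) (at x)"
    by (rule derivative_eq_intros d refl)+ simp
next
  show "continuous_on S (\<lambda>x. f2 x * g x + 2 * f1 x * g1 x + f x * g2 x)"
    by (intro continuous_intros C2_triple_continuous[OF assms(1)] C2_triple_continuous[OF assms(2)])
qed

lemma C2_triple_pospow:
  assumes "C2_triple S g g1 g2" "3 \<le> m"
  shows "C2_triple S (\<lambda>x. pospow m (g x)) (\<lambda>x. real m * pospow (m - 1) (g x) * g1 x)
    (\<lambda>x. real m * real (m - 1) * pospow (m - 2) (g x) * (g1 x)\<^sup>2 + real m * pospow (m - 1) (g x) * g2 x)"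
  unfolding C2_triple_def
proof (intro conjI ballI)
  fix x assume "x \<in> S"
  then have d: "(g has_real_derivative g1 x) (at x)" "(g1 has_real_derivative g2 x) (at x)"
    using assms by (auto simp: C2_triple_def)
  have "m - 1 - 1 = m - 2" by simp
  then have p: "((\<lambda>x. pospow m (g x)) has_real_derivative real m * pospow (m - 1) (g x) * g1 x) (at x)"
    "((\<lambda>x. pospow (m - 1) (g x)) has_real_derivative real (m - 1) * pospow (m - 2) (g x) * g1 x) (at x)"
    using DERIV_chain2[OF DERIV_pospow[of m "g x"] d(1)]
      DERIV_chain2[OF DERIV_pospow[of "m - 1" "g x"] d(1)] assms(2) by auto
  show "((\<lambda>x. pospow m (g x)) has_real_derivative real m * pospow (m - 1) (g x) * g1 x) (at x)"
    by (rule p)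
  show "((\<lambda>x. real m * pospow (m - 1) (g x) * g1 x) has_real_derivative
     real m * real (m - 1) * pospow (m - 2) (g x) * (g1 x)\<^sup>2 + real m * pospow (m - 1) (g x) * g2 x) (at x)"
    by (rule derivative_eq_intros d p refl)+ (simp add: power2_eq_square)
next
  show "continuous_on S (\<lambda>x. real m * real (m - 1) * pospow (m - 2) (g x) * (g1 x)\<^sup>2 +
      real m * pospow (m - 1) (g x) * g2 x)"
    by (intro continuous_intros C2_triple_continuous[OF assms(1)])
qed

lemma C2_triple_const: "C2_triple S (\<lambda>x. c) (\<lambda>x. 0) (\<lambda>x. 0)"
  by (simp add: C2_triple_def)

lemma deriv_twice_eq:
  assumes "open U" "x \<in> U" "\<And>y. y \<in> U \<Longrightarrow> (f has_real_derivative f1 y) (at y)"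
    and "(f1 has_real_derivative c) (at x)"
  shows "(deriv ^^ 2) f x = (c::real)"
proof -
  have "deriv (deriv f) x = deriv f1 x"
    using assms by (intro deriv_cong_ev) (auto simp: eventually_nhds intro!: DERIV_imp_deriv)
  then show ?thesis using assms(4) by (simp add: numeral_2_eq_2 DERIV_imp_deriv)
qed

section \<open>Functions of time and squared radius\<close>

text \<open>
  The spatial factor is a function of \<open>x \<bullet> x\<close> rather than of \<open>norm x\<close>: the squared radius is
  polynomial along every line, so all derivatives come from the chain rule in one variable.
\<close>

definition tensor :: "(real \<Rightarrow> real) \<Rightarrow> (real \<Rightarrow> real) \<Rightarrow> real \<times> 'a::euclidean_space \<Rightarrow> real" where
  "tensor a k = (\<lambda>(t, x). a t * k (x \<bullet> x))"

lemma has_derivative_tensor: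
  fixes x :: "'a::euclidean_space"
  assumes "(a has_real_derivative a1 t) (at t)" "(k has_real_derivative k1 (x \<bullet> x)) (at (x \<bullet> x))"
  shows "(tensor a k has_derivative
     (\<lambda>y. tensor a1 k (t, x) * fst y + 2 * tensor a k1 (t, x) * (x \<bullet> snd y))) (at (t, x))"
proof -
  have "((\<lambda>z::real \<times> 'a. a (fst z)) has_derivative (\<lambda>y. fst y * a1 t)) (at (t, x))"
    by (rule has_derivative_compose[of fst fst, where g = a and g' = "\<lambda>s. s * a1 t", simplified])
      (use assms(1) in \<open>auto intro!: derivative_eq_intros simp: has_field_derivative_def mult_commute_abs\<close>)
  moreover have "((\<lambda>z::real \<times> 'a. snd z \<bullet> snd z) has_derivative (\<lambda>y. 2 * (x \<bullet> snd y))) (at (t, x))"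
    by (auto intro!: derivative_eq_intros simp: inner_commute)
  then have "((\<lambda>z::real \<times> 'a. k (snd z \<bullet> snd z)) has_derivative
      (\<lambda>y. 2 * (x \<bullet> snd y) * k1 (x \<bullet> x))) (at (t, x))"
    by (rule has_derivative_compose[where g' = "\<lambda>s. s * k1 (x \<bullet> x)"])
      (use assms(2) in \<open>simp add: has_field_derivative_def mult_commute_abs\<close>)
  ultimately have "((\<lambda>z::real \<times> 'a. a (fst z) * k (snd z \<bullet> snd z)) has_derivative
      (\<lambda>y. a t * (2 * (x \<bullet> snd y) * k1 (x \<bullet> x)) + fst y * a1 t * k (x \<bullet> x))) (at (t, x))"
    by (auto intro!: derivative_eq_intros)
  then show ?thesis
    unfolding tensor_def case_prod_unfold by (simp add: algebra_simps)
qed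

lemma continuous_on_tensor:
  fixes S :: "(real \<times> 'a::euclidean_space) set"
  assumes "continuous_on UNIV a" "continuous_on {0<..} k" "\<And>z. z \<in> S \<Longrightarrow> snd z \<noteq> 0"
  shows "continuous_on S (tensor a k)"
proof -
  have "continuous_on S (\<lambda>z. a (fst z))"
    by (rule continuous_on_compose2[OF assms(1)]) (auto intro: continuous_intros)
  moreover have "continuous_on S (\<lambda>z. k (snd z \<bullet> snd z))"
    by (rule continuous_on_compose2[OF assms(2)]) (use assms(3) in \<open>auto intro!: continuous_intros\<close>)
  ultimately show ?thesis
    unfolding tensor_def case_prod_beta by (intro continuous_intros)
qed

text \<open>
  Both the differential and its derivative are combinations of two fixed operators, the time
  projection and the form \<open>y \<mapsto> z \<bullet> y\<close> on the spatial components (linear in the base point \<open>z\<close>),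
  with scalar coefficients that are again of tensor type.
\<close>

lemma C2_on_tensor:
  fixes S :: "(real \<times> 'a::euclidean_space) set"
  assumes a: "C2_triple UNIV a a1 a2" and k: "C2_triple {0<..} k k1 k2"
    and S: "\<And>z. z \<in> S \<Longrightarrow> snd z \<noteq> 0"
  shows "C2_on S (tensor a k)"
proof -
  have da: "(a has_real_derivative a1 t) (at t)" "(a1 has_real_derivative a2 t) (at t)" for t
    using a by (auto simp: C2_triple_def)
  have dk: "(k has_real_derivative k1 s) (at s)" "(k1 has_real_derivative k2 s) (at s)" if "s > 0" for s
    using k that by (auto simp: C2_triple_def)
  define M :: "(real \<times> 'a) \<Rightarrow>\<^sub>L ((real \<times> 'a) \<Rightarrow>\<^sub>L real)"
    where "M = Blinfun (\<lambda>z. blinfun_inner_right (snd z) o\<^sub>L snd_blinfun)"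
  have M: "blinfun_apply (blinfun_apply M z) y = snd z \<bullet> snd y" for z y
    unfolding M_def by (subst bounded_linear_Blinfun_apply) (auto intro!: bounded_linear_intros)
  define F :: "(real \<times> 'a) \<Rightarrow>\<^sub>L real" where "F = fst_blinfun"
  let ?D1 = "\<lambda>z. tensor a1 k z *\<^sub>R F + (2 * tensor a k1 z) *\<^sub>R blinfun_apply M z"
  let ?A = "\<lambda>z. tensor a2 k z *\<^sub>R F + (2 * tensor a1 k1 z) *\<^sub>R blinfun_apply M z"
  let ?B = "\<lambda>z. (2 * tensor a1 k1 z) *\<^sub>R F + (4 * tensor a k2 z) *\<^sub>R blinfun_apply M z"
  let ?D2 = "\<lambda>z. (blinfun_scaleR_left F o\<^sub>L ?A z) + (blinfun_scaleR_left (blinfun_apply M z) o\<^sub>L ?B z)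
    + (2 * tensor a k1 z) *\<^sub>R M"
  define U :: "(real \<times> 'a) set" where "U = UNIV \<times> (- {0})"
  have pos: "0 < x \<bullet> x" if "(t, x) \<in> U" for t x using that by (auto simp: U_def)
  show ?thesis
    unfolding C2_on_def
  proof (intro exI[of _ U] exI[of _ ?D1] exI[of _ ?D2] conjI ballI)
    show "open U" by (auto simp: U_def intro!: open_Times)
    show "S \<subseteq> U" using S by (force simp: U_def)
  next
    fix z assume "z \<in> U"
    moreover obtain t x where z: "z = (t, x)" by (cases z)
    ultimately have p: "0 < x \<bullet> x" using pos by blast
    note dt = has_derivative_tensor[of a _ t k _ x] has_derivative_tensor[of a1 _ t k _ x]
      has_derivative_tensor[of a _ t k1 _ x]
    have "(tensor a k has_derivative
        (\<lambda>y. tensor a1 k (t, x) * fst y + 2 * tensor a k1 (t, x) * (x \<bullet> snd y))) (at (t, x))"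
      by (intro dt da dk p)
    then show "(tensor a k has_derivative blinfun_apply (?D1 z)) (at z)"
      unfolding z by (rule has_derivative_eq_rhs) (auto simp: blinfun.add_left blinfun.scaleR_left M F_def)
    have "(tensor a1 k has_derivative
        (\<lambda>y. tensor a2 k (t, x) * fst y + 2 * tensor a1 k1 (t, x) * (x \<bullet> snd y))) (at (t, x))"
      by (intro dt da dk p)
    then have A: "(tensor a1 k has_derivative blinfun_apply (?A z)) (at z)"
      unfolding z by (rule has_derivative_eq_rhs) (auto simp: blinfun.add_left blinfun.scaleR_left M F_def)
    have "(tensor a k1 has_derivative
        (\<lambda>y. tensor a1 k1 (t, x) * fst y + 2 * tensor a k2 (t, x) * (x \<bullet> snd y))) (at (t, x))"
      by (intro dt da dk p)
    from has_derivative_mult_right[OF this, of 2]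
    have B: "((\<lambda>z. 2 * tensor a k1 z) has_derivative blinfun_apply (?B z)) (at z)"
      unfolding z by (rule has_derivative_eq_rhs) (auto simp: blinfun.add_left blinfun.scaleR_left M F_def algebra_simps)
    have "(blinfun_apply M has_derivative blinfun_apply M) (at z)"
      by (rule bounded_linear_imp_has_derivative[OF blinfun.bounded_linear_right])
    from has_derivative_add[OF has_derivative_scaleR[OF A has_derivative_const[of F]]
        has_derivative_scaleR[OF B this]]
    show "(?D1 has_derivative blinfun_apply (?D2 z)) (at z)"
      by (rule has_derivative_eq_rhs) (auto simp: blinfun.add_left blinfun.scaleR_left fun_eq_iff algebra_simps)
  next
    have c: "continuous_on UNIV a" "continuous_on UNIV a1" "continuous_on UNIV a2"
      "continuous_on {0<..} k" "continuous_on {0<..} k1" "continuous_on {0<..} k2"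
      using C2_triple_continuous[OF a] C2_triple_continuous[OF k] by auto
    have nz: "snd z \<noteq> 0" if "z \<in> U" for z using that by (auto simp: U_def)
    show "continuous_on U ?D2"
      by (intro continuous_intros continuous_on_tensor c nz
         linear_continuous_on bounded_linear.continuous_on[OF bounded_linear_blinfun_scaleR_left]
         bounded_bilinear.continuous_on[OF bounded_bilinear_blinfun_compose])
  qed
qed

lemma time_deriv_tensor:
  fixes x :: "'a::euclidean_space"
  assumes "C2_triple UNIV a a1 a2"
  shows "time_deriv (tensor a k) (t, x) = tensor a1 k (t, x)"
    and "time_deriv2 (tensor a k) (t, x) = tensor a2 k (t, x)"
proof -
  have d: "((\<lambda>s. a s * k (x \<bullet> x)) has_real_derivative a1 s * k (x \<bullet> x)) (at s)"
    "((\<lambda>s. a1 s * k (x \<bullet> x)) has_real_derivative a2 s * k (x \<bullet> x)) (at s)" for s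
    using assms by (auto simp: C2_triple_def intro!: DERIV_cmult_right)
  show "time_deriv (tensor a k) (t, x) = tensor a1 k (t, x)"
    by (simp add: time_deriv_def tensor_def DERIV_imp_deriv d)
  show "time_deriv2 (tensor a k) (t, x) = tensor a2 k (t, x)"
    unfolding time_deriv2_def tensor_def prod.case by (rule deriv_twice_eq[of UNIV]) (auto intro: d)
qed

text \<open>
  Along a coordinate direction \<open>b\<close> the squared radius is the quadratic polynomial
  \<open>x \<bullet> x + 2 h (x \<bullet> b) + h\<^sup>2\<close>; summing the second derivatives over the basis turns \<open>(x \<bullet> b)\<^sup>2\<close>
  into \<open>x \<bullet> x\<close>.
\<close>

lemma laplacian_tensor:
  fixes x :: "'a::euclidean_space"
  assumes k: "C2_triple {0<..} k k1 k2" and "x \<noteq> 0"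
  shows "laplacian (tensor a k) (t, x) =
    a t * (4 * (x \<bullet> x) * k2 (x \<bullet> x) + 2 * real DIM('a) * k1 (x \<bullet> x))"
proof -
  have *: "(deriv ^^ 2) (\<lambda>h. tensor a k (t, x + h *\<^sub>R b)) 0 =
      a t * (k2 (x \<bullet> x) * 4 * (x \<bullet> b)\<^sup>2 + 2 * k1 (x \<bullet> x))" if b: "b \<in> Basis" for b
  proof -
    define \<gamma> where "\<gamma> = (\<lambda>h. x \<bullet> x + 2 * h * (x \<bullet> b) + h\<^sup>2)"
    have \<gamma>: "(x + h *\<^sub>R b) \<bullet> (x + h *\<^sub>R b) = \<gamma> h" for h
      using b by (simp add: \<gamma>_def inner_simps inner_Basis power2_eq_square inner_commute algebra_simps)
    have d\<gamma>: "(\<gamma> has_real_derivative 2 * (x \<bullet> b) + 2 * h) (at h)" for h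
      unfolding \<gamma>_def by (auto intro!: derivative_eq_intros)
    have "continuous_on UNIV \<gamma>" unfolding \<gamma>_def by (intro continuous_intros)
    then have "open {h. 0 < \<gamma> h}" by (intro open_Collect_less) auto
    moreover have "\<gamma> 0 = x \<bullet> x" by (simp add: \<gamma>_def)
    moreover have 1: "((\<lambda>h. a t * k (\<gamma> h)) has_real_derivative a t * (k1 (\<gamma> h) * (2 * (x \<bullet> b) + 2 * h))) (at h)"
      if "0 < \<gamma> h" for h
      using k that by (intro DERIV_cmult DERIV_chain2[of k] d\<gamma>) (auto simp: C2_triple_def)
    moreover have "((\<lambda>h. a t * (k1 (\<gamma> h) * (2 * (x \<bullet> b) + 2 * h))) has_real_derivative
      a t * (k2 (\<gamma> 0) * (2 * (x \<bullet> b) + 2 * 0) * (2 * (x \<bullet> b) + 2 * 0) + 2 * k1 (\<gamma> 0))) (at 0)"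
    proof -
      have "((\<lambda>h. k1 (\<gamma> h)) has_real_derivative k2 (\<gamma> 0) * (2 * (x \<bullet> b) + 2 * 0)) (at 0)"
        using k \<open>x \<noteq> 0\<close> by (intro DERIV_chain2[of k1] d\<gamma>) (auto simp: C2_triple_def \<gamma>_def)
      then show ?thesis by (auto intro!: derivative_eq_intros)
    qed
    ultimately show ?thesis
      unfolding tensor_def prod.case \<gamma> using \<open>x \<noteq> 0\<close>
      by (subst deriv_twice_eq[of "{h. 0 < \<gamma> h}"]) (auto simp: power2_eq_square mult_ac)
  qed
  have "laplacian (tensor a k) (t, x) =
      (\<Sum>b\<in>Basis. a t * (k2 (x \<bullet> x) * 4 * (x \<bullet> b)\<^sup>2 + 2 * k1 (x \<bullet> x)))"
    by (simp add: laplacian_def *)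
  also have "\<dots> = a t * (k2 (x \<bullet> x) * 4 * (\<Sum>b\<in>Basis. (x \<bullet> b)\<^sup>2) + 2 * real DIM('a) * k1 (x \<bullet> x))"
    by (simp add: sum.distrib sum_distrib_left algebra_simps)
  also have "(\<Sum>b\<in>Basis. (x \<bullet> b)\<^sup>2) = x \<bullet> x"
    by (simp add: euclidean_inner[of x x] power2_eq_square)
  finally show ?thesis by (simp add: algebra_simps)
qed

text \<open>
  On the outer sphere the squared radius along the normal is \<open>(2 + h)\<^sup>2\<close>, with derivative \<open>4\<close>.
\<close>

lemma normal_deriv_tensor:
  fixes x :: "'a::euclidean_space"
  assumes "(k has_real_derivative k1 4) (at 4)" "x \<in> sphere 0 2"
  shows "normal_deriv (tensor a k) (t, x) = 4 * k1 4 * a t"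
proof -
  have n: "norm x = 2" using assms(2) by simp
  then have s: "x = 2 *\<^sub>R sgn x" "norm (sgn x) = 1" by (auto simp: sgn_div_norm)
  have "(x + h *\<^sub>R sgn x) \<bullet> (x + h *\<^sub>R sgn x) = (2 + h)\<^sup>2" for h
  proof -
    have "x + h *\<^sub>R sgn x = (2 + h) *\<^sub>R sgn x" by (subst (1) s(1)) (simp add: algebra_simps)
    then show ?thesis using s(2) by (simp add: power2_norm_eq_inner[symmetric] power_mult_distrib)
  qed
  moreover have "((\<lambda>h. a t * k ((2 + h)\<^sup>2)) has_real_derivative a t * (k1 4 * 4)) (at 0)"
    using assms(1) by (intro DERIV_cmult DERIV_chain2[of k]) (auto intro!: derivative_eq_intros)
  ultimately show ?thesis
    by (simp add: normal_deriv_def tensor_def DERIV_imp_deriv)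
qed

section \<open>Cutoff functions in time and space\<close>

text \<open>
  The condition \<open>m \<le> (m - 2) r\<close> says that the exponent left after two differentiations is still at
  least the fraction \<open>1 / r\<close> of the original one. It holds for all large \<open>m\<close> because \<open>r > 1\<close>.
\<close>

lemma pospow_le_powr:
  assumes "x \<le> 1" "3 \<le> m" "0 < r" "real m \<le> real (m - 2) * r"
  shows "pospow (m - 2) x \<le> pospow m x powr (1 / r)"
proof (cases "x > 0")
  case True
  have "x powr real (m - 2) \<le> x powr (real m / r)"
    using assms True by (intro powr_mono') (auto simp: field_simps)
  then show ?thesis
    using True by (simp add: pospow_def max_def powr_powr powr_realpow[symmetric] del: of_nat_diff)
qed (use assms in \<open>simp add: pospow_nonpos\<close>)

text \<open>
  The time cutoff lives on \<open>(T, 2 T)\<close>, away from \<open>t = 0\<close>, so that initial data never enter; its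
  derivatives are of size \<open>1 / T\<close> and hence negligible for large \<open>T\<close>.
\<close>

definition time_cut :: "nat \<Rightarrow> real \<Rightarrow> real \<Rightarrow> real" where
  "time_cut m T t = pospow m ((t / T - 1) * (2 - t / T))"

lemma time_cut_arg_le_1: "(t / T - 1) * (2 - t / T) \<le> (1::real)"
proof -
  have "0 \<le> (t / T - 3 / 2)\<^sup>2" by simp
  then show ?thesis by (simp add: power2_eq_square algebra_simps)
qed

lemma time_cut_bounds: "0 \<le> time_cut m T t" "time_cut m T t \<le> 1"
  by (simp_all add: time_cut_def pospow_le_1 time_cut_arg_le_1)

lemma time_cut_arg_nonpos:
  fixes T t :: real
  assumes "0 < T" "\<not> (T < t \<and> t < 2 * T)"
  shows "(t / T - 1) * (2 - t / T) \<le> 0"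
proof -
  have "t / T \<le> 1 \<or> 2 \<le> t / T" using assms by (auto simp: field_simps)
  then show ?thesis by (auto simp: mult_le_0_iff)
qed

lemma time_cut_eq_0:
  assumes "0 < T" "3 \<le> m" "\<not> (T < t \<and> t < 2 * T)"
  shows "time_cut m T t = 0"
  using time_cut_arg_nonpos[OF assms(1,3)] assms(2) by (simp add: time_cut_def pospow_nonpos)

lemma time_cut_lower:
  assumes "0 < T" "5 / 4 * T \<le> t" "t \<le> 7 / 4 * T"
  shows "(3 / 16) ^ m \<le> time_cut m T t"
proof -
  define y where "y = t / T"
  have "5 / 4 \<le> y" "y \<le> 7 / 4" using assms by (auto simp: y_def field_simps)
  then have "0 \<le> (y - 5 / 4) * (7 / 4 - y)" by simp
  then have "3 / 16 \<le> (y - 1) * (2 - y)" by (simp add: algebra_simps)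
  then have "3 / 16 \<le> (t / T - 1) * (2 - t / T)" by (simp add: y_def)
  then have "3 / 16 \<le> max 0 ((t / T - 1) * (2 - t / T))" by (rule max.coboundedI2)
  then show ?thesis unfolding time_cut_def pospow_def by (rule power_mono) simp
qed

text \<open>
  For \<open>T \<ge> 1\<close> the second derivative, naturally of size \<open>1 / T\<^sup>2\<close>, is also bounded by \<open>1 / T\<close>. This
  common bound is what lets the parabolic and the hyperbolic problem be treated at once.
\<close>

lemma time_cut_C2:
  assumes m: "3 \<le> m"
  obtains a1 a2 where
    "\<And>T. 0 < T \<Longrightarrow> C2_triple UNIV (time_cut m T) (a1 T) (a2 T)"
    "\<And>T t r. 1 \<le> T \<Longrightarrow> 0 < r \<Longrightarrow> real m \<le> real (m - 2) * r \<Longrightarrow>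
        \<bar>a1 T t\<bar> \<le> 4 * (real m)\<^sup>2 / T * time_cut m T t powr (1 / r) \<and>
        \<bar>a2 T t\<bar> \<le> 4 * (real m)\<^sup>2 / T * time_cut m T t powr (1 / r)"
proof -
  define g :: "real \<Rightarrow> real \<Rightarrow> real" where "g = (\<lambda>T t. (t / T - 1) * (2 - t / T))"
  define g1 :: "real \<Rightarrow> real \<Rightarrow> real" where "g1 = (\<lambda>T t. (3 - 2 * (t / T)) / T)"
  define g2 :: "real \<Rightarrow> real \<Rightarrow> real" where "g2 = (\<lambda>T t. - 2 / T\<^sup>2)"
  define a1 where "a1 = (\<lambda>T t. real m * pospow (m - 1) (g T t) * g1 T t)"
  define a2 where "a2 = (\<lambda>T t. real m * real (m - 1) * pospow (m - 2) (g T t) * (g1 T t)\<^sup>2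
      + real m * pospow (m - 1) (g T t) * g2 T t)"
  have g: "C2_triple UNIV (g T) (g1 T) (g2 T)" if "0 < T" for T
    unfolding C2_triple_def g_def g1_def g2_def using that
    by (auto intro!: derivative_eq_intros simp: field_simps power2_eq_square)
  have C2: "C2_triple UNIV (time_cut m T) (a1 T) (a2 T)" if "0 < T" for T
    using C2_triple_pospow[OF g[OF that] m] by (simp add: time_cut_def[abs_def] a1_def a2_def g_def)
  have b: "\<bar>a1 T t\<bar> \<le> 4 * (real m)\<^sup>2 / T * pospow (m - 2) (g T t) \<and>
      \<bar>a2 T t\<bar> \<le> 4 * (real m)\<^sup>2 / T * pospow (m - 2) (g T t)" if T: "1 \<le> T" for T t
  proof (cases "T < t \<and> t < 2 * T")
    case False
    then have "g T t \<le> 0" using time_cut_arg_nonpos[of T t] T by (simp add: g_def)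
    then show ?thesis using m by (simp add: a1_def a2_def pospow_nonpos)
  next
    case True
    let ?p = "pospow (m - 2) (g T t)"
    have "1 < t / T" "t / T < 2" using True T by (auto simp: field_simps)
    then have "\<bar>3 - 2 * (t / T)\<bar> \<le> 1" by linarith
    then have G1: "\<bar>g1 T t\<bar> \<le> 1 / T" using T by (simp add: g1_def abs_divide divide_right_mono)
    have "1 / T \<le> 1" using T by simp
    have T2: "1 / T\<^sup>2 \<le> 1 / T" using T by (simp add: field_simps power2_eq_square)
    have G12: "(g1 T t)\<^sup>2 \<le> 1 / T"
    proof -
      have "(g1 T t)\<^sup>2 \<le> (1 / T)\<^sup>2" using G1 T by (simp add: power2_le_iff_abs_le)
      then show ?thesis using T2 by (simp add: power_one_over)
    qed
    have G2: "\<bar>g2 T t\<bar> \<le> 2 / T" using T2 T by (simp add: g2_def)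
    have pp: "pospow (m - 1) (g T t) \<le> ?p"
      by (rule pospow_antimono) (use time_cut_arg_le_1 in \<open>auto simp: g_def\<close>)
    have m1: "1 \<le> real m" using m by simp
    have mm: "real m \<le> (real m)\<^sup>2" "real m * real (m - 1) \<le> (real m)\<^sup>2"
      using m1 by (auto simp: power2_eq_square mult_left_mono)
    have A: "real m * pospow (m - 1) (g T t) \<le> (real m)\<^sup>2 * ?p"
      using mm(1) pp by (intro mult_mono) auto
    have "\<bar>a1 T t\<bar> = (real m * pospow (m - 1) (g T t)) * \<bar>g1 T t\<bar>"
      by (simp add: a1_def abs_mult)
    also have "\<dots> \<le> ((real m)\<^sup>2 * ?p) * (1 / T)"
      by (rule mult_mono[OF A G1]) auto
    also have "\<dots> \<le> 4 * (real m)\<^sup>2 / T * ?p"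
      using T by (simp add: field_simps)
    finally have 1: "\<bar>a1 T t\<bar> \<le> 4 * (real m)\<^sup>2 / T * ?p" .
    have "\<bar>a2 T t\<bar> \<le> (real m * real (m - 1) * ?p) * (g1 T t)\<^sup>2
        + (real m * pospow (m - 1) (g T t)) * \<bar>g2 T t\<bar>"
      unfolding a2_def by (rule order_trans[OF abs_triangle_ineq]) (simp add: abs_mult)
    also have "\<dots> \<le> ((real m)\<^sup>2 * ?p) * (1 / T) + ((real m)\<^sup>2 * ?p) * (2 / T)"
      by (intro add_mono mult_mono A G12 G2 mm mult_right_mono) auto
    also have "\<dots> \<le> 4 * (real m)\<^sup>2 / T * ?p"
      using T by (simp add: field_simps)
    finally show ?thesis using 1 by blast
  qed
  have "\<bar>a1 T t\<bar> \<le> 4 * (real m)\<^sup>2 / T * time_cut m T t powr (1 / r) \<and>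
        \<bar>a2 T t\<bar> \<le> 4 * (real m)\<^sup>2 / T * time_cut m T t powr (1 / r)"
    if "1 \<le> T" "0 < r" "real m \<le> real (m - 2) * r" for T t r
  proof -
    have "4 * (real m)\<^sup>2 / T * pospow (m - 2) (g T t)
        \<le> 4 * (real m)\<^sup>2 / T * time_cut m T t powr (1 / r)"
      unfolding time_cut_def g_def
      by (intro mult_left_mono pospow_le_powr time_cut_arg_le_1) (use m that in auto)
    then show ?thesis using b[OF that(1), of t] by linarith
  qed
  with C2 show thesis by (rule that)
qed

text \<open>
  With \<open>\<tau> = x \<bullet> x\<close>, the spatial cutoff rises from 0 to 1 while \<open>\<tau> - 1\<close> runs from \<open>\<epsilon>\<close> to
  \<open>2 \<epsilon>\<close>. The inner cube makes it flatten to second order at the value 1, the outer power at the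
  value 0.
\<close>

definition space_cut :: "nat \<Rightarrow> real \<Rightarrow> real \<Rightarrow> real" where
  "space_cut m \<epsilon> \<tau> = pospow m (1 - pospow 3 (2 - (\<tau> - 1) / \<epsilon>))"

lemma space_cut_bounds: "0 \<le> space_cut m \<epsilon> \<tau>" "space_cut m \<epsilon> \<tau> \<le> 1"
  by (simp_all add: space_cut_def pospow_le_1)

lemma space_cut_eq_0:
  assumes "0 < \<epsilon>" "3 \<le> m" "\<tau> \<le> 1 + \<epsilon>"
  shows "space_cut m \<epsilon> \<tau> = 0"
proof -
  have "1 \<le> 2 - (\<tau> - 1) / \<epsilon>" using assms by (simp add: field_simps)
  then have "1 \<le> pospow 3 (2 - (\<tau> - 1) / \<epsilon>)" by (simp add: pospow_def)
  then show ?thesis using assms by (simp add: space_cut_def pospow_nonpos)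
qed

lemma space_cut_eq_1:
  assumes "0 < \<epsilon>" "1 + 2 * \<epsilon> \<le> \<tau>"
  shows "space_cut m \<epsilon> \<tau> = 1"
proof -
  have "2 - (\<tau> - 1) / \<epsilon> \<le> 0" using assms by (simp add: field_simps)
  then show ?thesis by (simp add: space_cut_def pospow_nonpos)
qed

text \<open>
  Both derivatives are supported in the transition layer. The first one, naturally of size \<open>1 / \<epsilon>\<close>,
  is given the weaker bound \<open>1 / \<epsilon>\<^sup>2\<close> of the second one, since the two always occur together.
\<close>

lemma space_cut_C2:
  assumes m: "3 \<le> m"
  obtains b1 b2 where
    "\<And>\<epsilon>. 0 < \<epsilon> \<Longrightarrow> C2_triple UNIV (space_cut m \<epsilon>) (b1 \<epsilon>) (b2 \<epsilon>)"
    "\<And>\<epsilon> \<tau>. 0 < \<epsilon> \<Longrightarrow> \<not> (1 + \<epsilon> < \<tau> \<and> \<tau> < 1 + 2 * \<epsilon>) \<Longrightarrow> b1 \<epsilon> \<tau> = 0 \<and> b2 \<epsilon> \<tau> = 0"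
    "\<And>\<epsilon> \<tau> r. 0 < \<epsilon> \<Longrightarrow> \<epsilon> \<le> 1 \<Longrightarrow> 0 < r \<Longrightarrow> real m \<le> real (m - 2) * r \<Longrightarrow>
        \<bar>b1 \<epsilon> \<tau>\<bar> \<le> 15 * (real m)\<^sup>2 / \<epsilon>\<^sup>2 * space_cut m \<epsilon> \<tau> powr (1 / r) \<and>
        \<bar>b2 \<epsilon> \<tau>\<bar> \<le> 15 * (real m)\<^sup>2 / \<epsilon>\<^sup>2 * space_cut m \<epsilon> \<tau> powr (1 / r)"
proof -
  define h :: "real \<Rightarrow> real \<Rightarrow> real" where "h = (\<lambda>\<epsilon> \<tau>. 2 - (\<tau> - 1) / \<epsilon>)"
  define g where "g = (\<lambda>\<epsilon> \<tau>. 1 - pospow 3 (h \<epsilon> \<tau>))"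
  define g1 where "g1 = (\<lambda>\<epsilon> \<tau>. 3 * pospow 2 (h \<epsilon> \<tau>) / \<epsilon>)"
  define g2 where "g2 = (\<lambda>\<epsilon> \<tau>. - 6 * pospow 1 (h \<epsilon> \<tau>) / \<epsilon>\<^sup>2)"
  define b1 where "b1 = (\<lambda>\<epsilon> \<tau>. real m * pospow (m - 1) (g \<epsilon> \<tau>) * g1 \<epsilon> \<tau>)"
  define b2 where "b2 = (\<lambda>\<epsilon> \<tau>. real m * real (m - 1) * pospow (m - 2) (g \<epsilon> \<tau>) * (g1 \<epsilon> \<tau>)\<^sup>2
      + real m * pospow (m - 1) (g \<epsilon> \<tau>) * g2 \<epsilon> \<tau>)"
  have g: "C2_triple UNIV (g \<epsilon>) (g1 \<epsilon>) (g2 \<epsilon>)" if "0 < \<epsilon>" for \<epsilon>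
  proof -
    have "C2_triple UNIV (h \<epsilon>) (\<lambda>\<tau>. - 1 / \<epsilon>) (\<lambda>\<tau>. 0)"
      unfolding C2_triple_def h_def using that by (auto intro!: derivative_eq_intros)
    from C2_triple_pospow[OF this, of 3]
    have "C2_triple UNIV (\<lambda>\<tau>. pospow 3 (h \<epsilon> \<tau>)) (\<lambda>\<tau>. - g1 \<epsilon> \<tau>) (\<lambda>\<tau>. - g2 \<epsilon> \<tau>)"
      by (simp add: g1_def g2_def power_divide)
    then have "(((\<lambda>\<tau>. pospow 3 (h \<epsilon> \<tau>)) has_real_derivative - g1 \<epsilon> \<tau>) (at \<tau>))"
      "(((\<lambda>\<tau>. - g1 \<epsilon> \<tau>) has_real_derivative - g2 \<epsilon> \<tau>) (at \<tau>))"
      "continuous_on UNIV (\<lambda>\<tau>. - g2 \<epsilon> \<tau>)" for \<tau>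
      by (auto simp: C2_triple_def)
    from DERIV_diff[OF DERIV_const[of 1] this(1)] DERIV_minus[OF this(2)] continuous_on_minus[OF this(3)]
    show ?thesis by (simp add: C2_triple_def g_def)
  qed
  have C2: "C2_triple UNIV (space_cut m \<epsilon>) (b1 \<epsilon>) (b2 \<epsilon>)" if "0 < \<epsilon>" for \<epsilon>
    using C2_triple_pospow[OF g[OF that] m]
    by (simp add: space_cut_def[abs_def] b1_def b2_def g_def h_def)
  have g_le: "g \<epsilon> \<tau> \<le> 1" for \<epsilon> \<tau> by (simp add: g_def)
  have zero: "b1 \<epsilon> \<tau> = 0 \<and> b2 \<epsilon> \<tau> = 0"
    if \<epsilon>: "0 < \<epsilon>" and out: "\<not> (1 + \<epsilon> < \<tau> \<and> \<tau> < 1 + 2 * \<epsilon>)" for \<epsilon> \<tau>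
  proof (cases "\<tau> \<le> 1 + \<epsilon>")
    case True
    then have "1 \<le> h \<epsilon> \<tau>" using \<epsilon> by (simp add: h_def field_simps)
    then have "1 \<le> pospow 3 (h \<epsilon> \<tau>)" by (simp add: pospow_def)
    then show ?thesis using m by (simp add: b1_def b2_def g_def pospow_nonpos)
  next
    case False
    then have "h \<epsilon> \<tau> \<le> 0" using \<epsilon> out by (simp add: h_def field_simps)
    then show ?thesis by (simp add: b1_def b2_def g1_def g2_def pospow_nonpos)
  qed
  have b: "\<bar>b1 \<epsilon> \<tau>\<bar> \<le> 15 * (real m)\<^sup>2 / \<epsilon>\<^sup>2 * pospow (m - 2) (g \<epsilon> \<tau>) \<and>
      \<bar>b2 \<epsilon> \<tau>\<bar> \<le> 15 * (real m)\<^sup>2 / \<epsilon>\<^sup>2 * pospow (m - 2) (g \<epsilon> \<tau>)"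
    if \<epsilon>: "0 < \<epsilon>" "\<epsilon> \<le> 1" for \<epsilon> \<tau>
  proof (cases "1 + \<epsilon> < \<tau> \<and> \<tau> < 1 + 2 * \<epsilon>")
    case False
    then show ?thesis using zero[OF \<epsilon>(1)] by simp
  next
    case True
    let ?p = "pospow (m - 2) (g \<epsilon> \<tau>)"
    have "h \<epsilon> \<tau> \<le> 1" using True \<epsilon> by (simp add: h_def field_simps)
    then have p1: "pospow k (h \<epsilon> \<tau>) \<le> 1" for k by (rule pospow_le_1)
    have G1: "\<bar>g1 \<epsilon> \<tau>\<bar> \<le> 3 / \<epsilon>"
      using p1[of 2] \<epsilon> by (simp add: g1_def divide_right_mono)
    have G12: "(g1 \<epsilon> \<tau>)\<^sup>2 \<le> 9 / \<epsilon>\<^sup>2"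
    proof -
      have "(g1 \<epsilon> \<tau>)\<^sup>2 \<le> (3 / \<epsilon>)\<^sup>2" using G1 \<epsilon> by (simp add: power2_le_iff_abs_le)
      then show ?thesis by (simp add: power_divide)
    qed
    have G2: "\<bar>g2 \<epsilon> \<tau>\<bar> \<le> 6 / \<epsilon>\<^sup>2" using p1[of 1] \<epsilon> by (simp add: g2_def divide_right_mono)
    have G1': "\<bar>g1 \<epsilon> \<tau>\<bar> \<le> 15 / \<epsilon>\<^sup>2"
    proof -
      have "3 / \<epsilon> \<le> 15 / \<epsilon>\<^sup>2" using \<epsilon> by (simp add: field_simps power2_eq_square)
      then show ?thesis using G1 by linarith
    qed
    have pp: "pospow (m - 1) (g \<epsilon> \<tau>) \<le> ?p"
      by (rule pospow_antimono) (use g_le in auto)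
    have m1: "1 \<le> real m" using m by simp
    have mm: "real m \<le> (real m)\<^sup>2" "real m * real (m - 1) \<le> (real m)\<^sup>2"
      using m1 by (auto simp: power2_eq_square mult_left_mono)
    have A: "real m * pospow (m - 1) (g \<epsilon> \<tau>) \<le> (real m)\<^sup>2 * ?p"
      using mm(1) pp by (intro mult_mono) auto
    have "\<bar>b1 \<epsilon> \<tau>\<bar> = (real m * pospow (m - 1) (g \<epsilon> \<tau>)) * \<bar>g1 \<epsilon> \<tau>\<bar>"
      by (simp add: b1_def abs_mult)
    also have "\<dots> \<le> ((real m)\<^sup>2 * ?p) * (15 / \<epsilon>\<^sup>2)"
      by (rule mult_mono[OF A G1']) auto
    finally have 1: "\<bar>b1 \<epsilon> \<tau>\<bar> \<le> 15 * (real m)\<^sup>2 / \<epsilon>\<^sup>2 * ?p" by (simp add: mult_ac)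
    have "\<bar>b2 \<epsilon> \<tau>\<bar> \<le> (real m * real (m - 1) * ?p) * (g1 \<epsilon> \<tau>)\<^sup>2
        + (real m * pospow (m - 1) (g \<epsilon> \<tau>)) * \<bar>g2 \<epsilon> \<tau>\<bar>"
      unfolding b2_def by (rule order_trans[OF abs_triangle_ineq]) (simp add: abs_mult)
    also have "\<dots> \<le> ((real m)\<^sup>2 * ?p) * (9 / \<epsilon>\<^sup>2) + ((real m)\<^sup>2 * ?p) * (6 / \<epsilon>\<^sup>2)"
      by (intro add_mono mult_mono A G12 G2 mm mult_right_mono) auto
    also have "\<dots> = 15 * (real m)\<^sup>2 / \<epsilon>\<^sup>2 * ?p"
      by (simp add: field_simps)
    finally show ?thesis using 1 by blast
  qed
  have "\<bar>b1 \<epsilon> \<tau>\<bar> \<le> 15 * (real m)\<^sup>2 / \<epsilon>\<^sup>2 * space_cut m \<epsilon> \<tau> powr (1 / r) \<and>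
        \<bar>b2 \<epsilon> \<tau>\<bar> \<le> 15 * (real m)\<^sup>2 / \<epsilon>\<^sup>2 * space_cut m \<epsilon> \<tau> powr (1 / r)"
    if "0 < \<epsilon>" "\<epsilon> \<le> 1" "0 < r" "real m \<le> real (m - 2) * r" for \<epsilon> \<tau> r
  proof -
    have "pospow (m - 2) (g \<epsilon> \<tau>) \<le> space_cut m \<epsilon> \<tau> powr (1 / r)"
      using pospow_le_powr[OF g_le m that(3,4)] by (simp add: space_cut_def g_def h_def)
    then have "15 * (real m)\<^sup>2 / \<epsilon>\<^sup>2 * pospow (m - 2) (g \<epsilon> \<tau>)
        \<le> 15 * (real m)\<^sup>2 / \<epsilon>\<^sup>2 * space_cut m \<epsilon> \<tau> powr (1 / r)"
      by (rule mult_left_mono) auto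
    then show ?thesis using b[OF that(1,2), of \<tau>] by linarith
  qed
  with C2 zero show thesis by (rule that)
qed

text \<open>
  Young's inequality up to constants. The free parameter \<open>l\<close> takes over the optimisation that is
  usually done by Hoelder's inequality; the proof just distinguishes which of \<open>y\<close> and
  \<open>l * x powr (r - 1)\<close> is larger.
\<close>

lemma weighted_young:
  fixes x y l r :: real
  assumes "0 \<le> x" "0 \<le> y" "0 < l" "1 < r"
  shows "x * y \<le> l * x powr r + l powr (- 1 / (r - 1)) * y powr (r / (r - 1))"
proof (cases "y \<le> l * x powr (r - 1)")
  case True
  then have "x * y \<le> x * (l * x powr (r - 1))" using assms by (intro mult_left_mono)
  also have "\<dots> = l * x powr r"
    using assms by (cases "x = 0") (auto simp: powr_mult_base)
  finally show ?thesis by (smt (verit) powr_ge_zero mult_nonneg_nonneg)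
next
  case False
  then have "0 < y" using assms by (smt (verit) powr_ge_zero mult_nonneg_nonneg)
  have "x = (x powr (r - 1)) powr (1 / (r - 1))"
    using assms by (cases "x = 0") (auto simp: powr_powr)
  also have "\<dots> \<le> (y / l) powr (1 / (r - 1))"
    using False assms by (intro powr_mono2) (auto simp: field_simps)
  also have "\<dots> = l powr (- 1 / (r - 1)) * y powr (1 / (r - 1))"
    using assms \<open>0 < y\<close> by (simp add: powr_divide powr_minus divide_simps)
  finally have "x * y \<le> l powr (- 1 / (r - 1)) * y powr (1 / (r - 1)) * y"
    using assms by (intro mult_right_mono)
  also have "\<dots> = l powr (- 1 / (r - 1)) * y powr (r / (r - 1))"
  proof -
    have "y powr (1 / (r - 1)) * y = y powr (1 / (r - 1) + 1)"
      using \<open>0 < y\<close> by (simp add: powr_add)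
    moreover have "1 / (r - 1) + 1 = r / (r - 1)" using assms by (simp add: field_simps)
    ultimately show ?thesis by (simp add: mult.assoc)
  qed
  finally show ?thesis using assms by (smt (verit) powr_ge_zero mult_nonneg_nonneg)
qed

section \<open>Radial test functions on the shell\<close>

lemma Q_dom_infinity: "(t, x) \<in> Q_dom \<infinity> \<longleftrightarrow> 0 < t \<and> x \<in> shell"
  by (simp add: Q_dom_def)

lemma shell_inner: "x \<in> shell \<longleftrightarrow> 1 < x \<bullet> x \<and> x \<bullet> x \<le> 4"
proof -
  have "1 < norm x \<longleftrightarrow> 1 < (norm x)\<^sup>2"
    using power2_le_iff_abs_le[of 1 "norm x"] by (smt (verit) norm_ge_zero one_power2 power2_le_imp_le power_mono)
  moreover have "norm x \<le> 2 \<longleftrightarrow> (norm x)\<^sup>2 \<le> 2\<^sup>2"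
    by (metis norm_ge_zero power2_le_imp_le power_mono zero_le_numeral)
  ultimately show ?thesis by (simp add: shell_def power2_norm_eq_inner)
qed

lemma shell_borel [measurable]: "shell \<in> sets borel"
  unfolding shell_def by measurable

definition radial_test :: "nat \<Rightarrow> (real \<Rightarrow> real) \<Rightarrow> real \<Rightarrow> real \<Rightarrow> real \<times> 'a::euclidean_space \<Rightarrow> real" where
  "radial_test m H T \<epsilon> = tensor (time_cut m T) (\<lambda>\<tau>. H \<tau> * space_cut m \<epsilon> \<tau>)"

text \<open>
  The layer in which the spatial cutoff is neither 0 nor 1.
\<close>

definition annulus :: "real \<Rightarrow> 'a::euclidean_space set" where
  "annulus \<epsilon> = {x. 1 + \<epsilon> < x \<bullet> x \<and> x \<bullet> x < 1 + 2 * \<epsilon>}"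

lemma annulus_borel [measurable]: "annulus \<epsilon> \<in> sets borel"
  unfolding annulus_def by measurable

lemma annulus_subset_shell: "0 \<le> \<epsilon> \<Longrightarrow> \<epsilon> \<le> 1 / 2 \<Longrightarrow> annulus \<epsilon> \<subseteq> shell"
  by (auto simp: annulus_def shell_inner)

text \<open>
  The layer lies between two concentric spheres whose radii differ by at most \<open>\<epsilon>\<close>.
\<close>

lemma measure_annulus_le:
  assumes "0 < \<epsilon>" "\<epsilon> \<le> 1"
  shows "measure lborel (annulus \<epsilon> :: 'a::euclidean_space set) \<le>
    unit_ball_vol (real DIM('a)) * real DIM('a) * 2 ^ DIM('a) * \<epsilon>"
proof -
  define a where "a = sqrt (1 + \<epsilon>)"
  define b where "b = sqrt (1 + 2 * \<epsilon>)"
  have sq: "a\<^sup>2 = 1 + \<epsilon>" "b\<^sup>2 = 1 + 2 * \<epsilon>" and ab: "1 \<le> a" "a \<le> b"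
    using assms by (auto simp: a_def b_def)
  have "b\<^sup>2 \<le> 2\<^sup>2" using assms sq by simp
  then have b2: "b \<le> 2" by (rule power2_le_imp_le) simp
  have "(b - a) * (b + a) = \<epsilon>" using sq by (simp add: algebra_simps power2_eq_square)
  moreover have "(b - a) * 1 \<le> (b - a) * (b + a)" using ab by (intro mult_left_mono) auto
  ultimately have ba: "b - a \<le> \<epsilon>" by simp
  have pw: "b ^ k - a ^ k \<le> real k * 2 ^ k * (b - a)" for k
  proof (induction k)
    case (Suc k)
    have "b ^ Suc k - a ^ Suc k = b * (b ^ k - a ^ k) + a ^ k * (b - a)" by (simp add: algebra_simps)
    also have "\<dots> \<le> 2 * (real k * 2 ^ k * (b - a)) + 2 ^ k * (b - a)"
    proof (rule add_mono)
      show "b * (b ^ k - a ^ k) \<le> 2 * (real k * 2 ^ k * (b - a))"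
        using b2 ab Suc.IH by (intro mult_mono) (auto intro: power_mono)
      show "a ^ k * (b - a) \<le> 2 ^ k * (b - a)"
        using b2 ab by (intro mult_right_mono power_mono) auto
    qed
    also have "\<dots> \<le> real (Suc k) * 2 ^ Suc k * (b - a)" using ab by (simp add: algebra_simps)
    finally show ?case .
  qed simp
  let ?V = "unit_ball_vol (real DIM('a))"
  have sub: "(annulus \<epsilon> :: 'a set) \<subseteq> ball 0 b - cball 0 a"
  proof
    fix x :: 'a assume "x \<in> annulus \<epsilon>"
    then have "a\<^sup>2 < (norm x)\<^sup>2" "(norm x)\<^sup>2 < b\<^sup>2" by (auto simp: annulus_def sq power2_norm_eq_inner)
    then have "a < norm x" "norm x < b" using ab
      by (auto intro: power2_less_imp_less)
    then show "x \<in> ball 0 b - cball 0 a" by auto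
  qed
  have "emeasure lborel (ball 0 b - cball 0 a :: 'a set) \<le> emeasure lborel (ball 0 b :: 'a set)"
    by (intro emeasure_mono) auto
  then have fin: "emeasure lborel (ball 0 b - cball 0 a :: 'a set) < \<infinity>"
    using emeasure_lborel_ball_finite by (rule le_less_trans)
  have "measure lborel (annulus \<epsilon> :: 'a set) \<le> measure lborel (ball 0 b - cball 0 a :: 'a set)"
    by (rule measure_mono_fmeasurable[OF sub]) (use fin in \<open>auto intro!: fmeasurableI\<close>)
  also have "\<dots> = measure lborel (ball 0 b :: 'a set) - measure lborel (cball 0 a :: 'a set)"
  proof (rule measure_Diff)
    show "emeasure lborel (ball 0 b :: 'a set) \<noteq> \<infinity>" using emeasure_lborel_ball_finite[of "0::'a" b] by auto
    show "cball 0 a \<subseteq> (ball 0 b :: 'a set)"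
    proof -
      have "a < b" using assms by (simp add: a_def b_def)
      then show ?thesis by auto
    qed
  qed auto
  also have "\<dots> = ?V * (b ^ DIM('a) - a ^ DIM('a))"
    using ab by (simp add: content_ball content_cball right_diff_distrib)
  also have "\<dots> \<le> ?V * (real DIM('a) * 2 ^ DIM('a) * \<epsilon>)"
    by (intro mult_left_mono order_trans[OF pw]) (use ba in auto)
  finally show ?thesis by (simp add: mult.assoc)
qed

lemma measure_shell_finite: "emeasure lborel (shell :: 'a::euclidean_space set) < \<infinity>"
proof -
  have "emeasure lborel (shell :: 'a set) \<le> emeasure lborel (cball 0 2 :: 'a set)"
    by (intro emeasure_mono) (auto simp: shell_def)
  also have "\<dots> < \<infinity>" by (rule emeasure_lborel_cball_finite)
  finally show ?thesis .
qed

lemma integral_indicator_box: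
  fixes S :: "'a::euclidean_space set"
  assumes S: "S \<in> sets borel" "S \<subseteq> shell" and "a \<le> b"
  shows "integrable lebesgue (indicator ({a<..<b} \<times> S) :: _ \<Rightarrow> real)"
    and "integral\<^sup>L lebesgue (indicator ({a<..<b} \<times> S) :: _ \<Rightarrow> real) = (b - a) * measure lborel S"
proof -
  have fin: "emeasure lborel S < \<infinity>"
    using emeasure_mono[of S shell lborel] S measure_shell_finite by (auto intro: le_less_trans)
  have box: "{a<..<b} \<times> S \<in> sets borel"
    using S by (auto simp: borel_prod[symmetric])
  have "emeasure lborel ({a<..<b} \<times> S) = emeasure lborel {a<..<b} * emeasure lborel S"
    using S by (subst lborel_prod[symmetric]) (rule lborel.emeasure_pair_measure_Times, auto)
  also have "\<dots> = ennreal ((b - a) * measure lborel S)"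
    using assms(3) fin by (simp add: emeasure_eq_ennreal_measure ennreal_mult)
  finally have e: "emeasure lebesgue ({a<..<b} \<times> S) = ennreal ((b - a) * measure lborel S)"
    using box by simp
  show "integrable lebesgue (indicator ({a<..<b} \<times> S) :: _ \<Rightarrow> real)"
    using box e by (intro integrable_real_indicator) auto
  show "integral\<^sup>L lebesgue (indicator ({a<..<b} \<times> S) :: _ \<Rightarrow> real) = (b - a) * measure lborel S"
    using box e assms(3) by (simp add: measure_def)
qed

text \<open>
  Only the majorant has to be integrable: the Bochner integral of a non-integrable function is 0,
  which is also below the integral of a nonnegative majorant. The lemma is used for products of a
  solution with derivatives of a test function.
\<close>

lemma int_Q_le:
  fixes P F :: "real \<times> 'a::euclidean_space \<Rightarrow> real"
  assumes P: "set_integrable lebesgue (Q_dom \<infinity>) P" "\<And>z. z \<in> Q_dom \<infinity> \<Longrightarrow> 0 \<le> P z"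
    and S: "S \<in> sets borel" "S \<subseteq> shell" and ab: "0 \<le> a" "a \<le> b" and c: "0 \<le> c" "0 \<le> E"
    and le: "\<And>z. z \<in> Q_dom \<infinity> \<Longrightarrow> F z \<le> c * P z + E * indicator ({a<..<b} \<times> S) z"
  shows "int_Q \<infinity> F \<le> c * int_Q \<infinity> P + E * ((b - a) * measure lborel S)"
proof -
  let ?I = "indicator (Q_dom \<infinity>) :: real \<times> 'a \<Rightarrow> real"
  let ?B = "indicator ({a<..<b} \<times> S) :: real \<times> 'a \<Rightarrow> real"
  have sub: "{a<..<b} \<times> S \<subseteq> Q_dom \<infinity>" using S ab by (auto simp: Q_dom_def)
  have i1: "integrable lebesgue (\<lambda>z. ?I z * P z)" using P(1) by (simp add: set_integrable_def)
  note i2 = integral_indicator_box[OF S ab(2)]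
  have "int_Q \<infinity> F \<le> integral\<^sup>L lebesgue (\<lambda>z. c * (?I z * P z) + E * ?B z)"
    unfolding int_Q_def set_lebesgue_integral_def
  proof (rule integral_mono')
    show "integrable lebesgue (\<lambda>z. c * (?I z * P z) + E * ?B z)"
      by (intro Bochner_Integration.integrable_add integrable_mult_right i1 i2)
    show "?I z *\<^sub>R F z \<le> c * (?I z * P z) + E * ?B z" for z
      using le[of z] sub by (auto simp: indicator_def)
    show "0 \<le> c * (?I z * P z) + E * ?B z" for z
      using P(2)[of z] c by (auto simp: indicator_def)
  qed
  also have "\<dots> = c * int_Q \<infinity> P + E * ((b - a) * measure lborel S)"
    using i1 i2 by (simp add: int_Q_def set_lebesgue_integral_def Bochner_Integration.integral_add integrable_mult_right)
  finally show ?thesis .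
qed

text \<open>
  The equation is the Laplace equation for \<open>x \<mapsto> H (x \<bullet> x)\<close> in dimension \<open>n\<close>. For the Neumann
  problem \<open>H = 1\<close> is used, for the Dirichlet problem the radial harmonic function that vanishes on the
  outer sphere. Harmonicity ensures that the Laplacian of \<open>H\<close> times a cutoff only contains
  derivatives of the cutoff, and positivity up to \<open>\<tau> = 2\<close> makes \<open>H\<close> comparable to 1 in the layers where
  these derivatives live.
\<close>

locale radial_harmonic =
  fixes H H1 H2 :: "real \<Rightarrow> real" and n :: nat
  assumes C2: "C2_triple {0<..} H H1 H2"
    and harmonic: "\<And>\<tau>. 0 < \<tau> \<Longrightarrow> 4 * \<tau> * H2 \<tau> + 2 * real n * H1 \<tau> = 0"
    and nonneg: "\<And>\<tau>. 1 \<le> \<tau> \<Longrightarrow> \<tau> \<le> 4 \<Longrightarrow> 0 \<le> H \<tau>"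
    and positive: "\<And>\<tau>. 1 \<le> \<tau> \<Longrightarrow> \<tau> \<le> 2 \<Longrightarrow> 0 < H \<tau>"
begin

lemma profile_bounds:
  obtains B c where "1 \<le> B" "0 < c" "\<And>\<tau>. 1 \<le> \<tau> \<Longrightarrow> \<tau> \<le> 4 \<Longrightarrow> H \<tau> \<le> B \<and> \<bar>H1 \<tau>\<bar> \<le> B"
    "\<And>\<tau>. 1 \<le> \<tau> \<Longrightarrow> \<tau> \<le> 2 \<Longrightarrow> c \<le> H \<tau>"
proof -
  have cont: "continuous_on {1..4} H" "continuous_on {1..4} (\<lambda>\<tau>. \<bar>H1 \<tau>\<bar>)" "continuous_on {1..2} H"
    using C2_triple_continuous[OF C2]
    by (auto intro!: continuous_intros elim!: continuous_on_subset)
  obtain B1 where B1: "\<forall>\<tau>\<in>{1..4}. H \<tau> \<le> H B1"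
    using continuous_attains_sup[OF compact_Icc _ cont(1)] by auto
  obtain B2 where B2: "\<forall>\<tau>\<in>{1..4}. \<bar>H1 \<tau>\<bar> \<le> \<bar>H1 B2\<bar>"
    using continuous_attains_sup[OF compact_Icc _ cont(2)] by auto
  obtain c where c: "c \<in> {1..2}" "\<forall>\<tau>\<in>{1..2}. H c \<le> H \<tau>"
    using continuous_attains_inf[OF compact_Icc _ cont(3)] by auto
  show thesis
    by (rule that[of "max 1 (max (H B1) \<bar>H1 B2\<bar>)" "H c"])
      (use B1 B2 c positive[of c] in \<open>auto simp: le_max_iff_disj\<close>)
qed

lemma profile_C2:
  assumes "C2_triple UNIV (space_cut m \<epsilon>) b1 b2"
  shows "C2_triple {0<..} (\<lambda>\<tau>. H \<tau> * space_cut m \<epsilon> \<tau>) (\<lambda>\<tau>. H1 \<tau> * space_cut m \<epsilon> \<tau> + H \<tau> * b1 \<tau>)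
      (\<lambda>\<tau>. H2 \<tau> * space_cut m \<epsilon> \<tau> + 2 * H1 \<tau> * b1 \<tau> + H \<tau> * b2 \<tau>)"
  by (rule C2_triple_mult[OF C2]) (use assms in \<open>auto simp: C2_triple_def intro: continuous_on_subset\<close>)

lemma radial_test_nonneg:
  assumes "z \<in> Q_dom \<infinity>"
  shows "0 \<le> radial_test m H T \<epsilon> z"
  using assms by (cases z) (auto simp: radial_test_def tensor_def Q_dom_infinity shell_inner
      intro!: mult_nonneg_nonneg time_cut_bounds space_cut_bounds nonneg)

lemma radial_test_support:
  assumes "0 < T" "0 < \<epsilon>" "3 \<le> m"
  obtains K :: "(real \<times> 'a::euclidean_space) set" where "compact K" "K \<subseteq> Q_dom \<infinity>"
    "\<And>z. z \<in> Q_dom \<infinity> - K \<Longrightarrow> radial_test m H T \<epsilon> z = 0"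
proof
  let ?S = "{x::'a. 1 + \<epsilon> \<le> x \<bullet> x} \<inter> cball 0 2"
  show "compact ({T..2 * T} \<times> ?S)"
    by (intro compact_Times closed_Int_compact compact_cball compact_Icc closed_Collect_le continuous_intros)
  have "x \<in> shell" if "x \<in> ?S" for x :: 'a
  proof -
    have "(norm x)\<^sup>2 \<le> 2\<^sup>2" using that by (intro power_mono) auto
    then show ?thesis using that assms by (auto simp: shell_inner power2_norm_eq_inner)
  qed
  then show "{T..2 * T} \<times> ?S \<subseteq> Q_dom \<infinity>"
    using assms by (auto simp: Q_dom_def)
  show "radial_test m H T \<epsilon> z = 0" if z: "z \<in> Q_dom \<infinity> - {T..2 * T} \<times> ?S" for z
  proof -
    obtain t x where tx: "z = (t, x)" by (cases z)
    with z have "\<not> (T < t \<and> t < 2 * T) \<or> x \<bullet> x \<le> 1 + \<epsilon>"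
      by (auto simp: Q_dom_infinity shell_def)
    then show ?thesis
      using time_cut_eq_0[of T m t] space_cut_eq_0[of \<epsilon> m "x \<bullet> x"] assms
      by (auto simp: radial_test_def tensor_def tx)
  qed
qed

lemma radial_test_C2_on:
  assumes "0 < T" "0 < \<epsilon>" "3 \<le> m"
  shows "C2_on (Q_dom \<infinity>) (radial_test m H T \<epsilon>)"
proof -
  obtain a1 a2 where "C2_triple UNIV (time_cut m T) (a1 T) (a2 T)"
    using time_cut_C2[OF assms(3)] assms(1) by metis
  moreover obtain b1 b2 where "C2_triple UNIV (space_cut m \<epsilon>) (b1 \<epsilon>) (b2 \<epsilon>)"
    using space_cut_C2[OF assms(3)] assms(2) by metis
  then have "C2_triple {0<..} (\<lambda>\<tau>. H \<tau> * space_cut m \<epsilon> \<tau>) (\<lambda>\<tau>. H1 \<tau> * space_cut m \<epsilon> \<tau> + H \<tau> * b1 \<epsilon> \<tau>)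
      (\<lambda>\<tau>. H2 \<tau> * space_cut m \<epsilon> \<tau> + 2 * H1 \<tau> * b1 \<epsilon> \<tau> + H \<tau> * b2 \<epsilon> \<tau>)"
    by (rule profile_C2)
  ultimately show ?thesis
    unfolding radial_test_def
    by (rule C2_on_tensor) (auto simp: Q_dom_def shell_def)
qed

lemma radial_test_is_test_function:
  assumes "0 < T" "0 < \<epsilon>" "3 \<le> m"
  shows "test_function \<infinity> (radial_test m H T \<epsilon> :: real \<times> 'a::euclidean_space \<Rightarrow> real)"
proof -
  obtain K :: "(real \<times> 'a) set" where "compact K" "K \<subseteq> Q_dom \<infinity>"
    "\<And>z. z \<in> Q_dom \<infinity> - K \<Longrightarrow> radial_test m H T \<epsilon> z = 0"
    using radial_test_support[OF assms] by blast
  then show ?thesis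
    unfolding test_function_def C2c_def
    using radial_test_C2_on[OF assms] radial_test_nonneg by auto
qed

text \<open>
  The support of the test function is a compact subset of the domain, hence stays away from the inner
  sphere where the weight is singular.
\<close>

lemma weighted_integrable:
  fixes y :: "real \<times> 'a::euclidean_space \<Rightarrow> real"
  assumes y: "Lp_loc r (Q_dom \<infinity>) y" and T: "0 < T" "0 < \<epsilon>" "3 \<le> m"
  shows "set_integrable lebesgue (Q_dom \<infinity>) (\<lambda>z. weight \<rho> z * \<bar>y z\<bar> powr r * radial_test m H T \<epsilon> z)"
proof -
  obtain K :: "(real \<times> 'a) set" where K: "compact K" "K \<subseteq> Q_dom \<infinity>"
    "\<And>z. z \<in> Q_dom \<infinity> - K \<Longrightarrow> radial_test m H T \<epsilon> z = 0"
    using radial_test_support[OF T] by blast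
  define h where "h z = weight \<rho> z * radial_test m H T \<epsilon> z" for z :: "real \<times> 'a"
  have "continuous_on (Q_dom \<infinity>) (radial_test m H T \<epsilon> :: real \<times> 'a \<Rightarrow> real)"
  proof -
    obtain U and \<phi>' :: "real \<times> 'a \<Rightarrow> (real \<times> 'a) \<Rightarrow>\<^sub>L real" where "Q_dom \<infinity> \<subseteq> U"
      "\<And>z. z \<in> U \<Longrightarrow> (radial_test m H T \<epsilon> has_derivative blinfun_apply (\<phi>' z)) (at z)"
      using radial_test_C2_on[OF T] unfolding C2_on_def by blast
    then show ?thesis
      by (meson continuous_at_imp_continuous_on has_derivative_continuous subsetD)
  qed
  moreover have "continuous_on (Q_dom \<infinity>) (weight \<rho> :: real \<times> 'a \<Rightarrow> real)"
    unfolding weight_def case_prod_unfold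
    by (intro continuous_intros) (auto simp: Q_dom_def shell_def)
  ultimately have "continuous_on K h"
    unfolding h_def using K(2) by (intro continuous_on_mult) (auto intro: continuous_on_subset)
  then have bdd: "bounded (h ` K)" and meas: "(\<lambda>z. indicator K z *\<^sub>R h z) \<in> borel_measurable borel"
    using K(1) by (blast intro: compact_imp_bounded compact_continuous_image
        borel_measurable_continuous_on_indicator borel_compact)+
  obtain B where B: "\<And>z. z \<in> K \<Longrightarrow> \<bar>h z\<bar> \<le> B" using bdd by (auto simp: bounded_iff)
  have int: "integrable lebesgue (\<lambda>z. indicator K z *\<^sub>R \<bar>y z\<bar> powr r)"
    using y K unfolding Lp_loc_def set_integrable_def by blast
  have "integrable lebesgue (\<lambda>z. (indicator K z *\<^sub>R h z) * (indicator K z *\<^sub>R \<bar>y z\<bar> powr r))"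
  proof (rule Bochner_Integration.integrable_bound[OF integrable_mult_right[OF int, of "\<bar>B\<bar>"]])
    show "(\<lambda>z. (indicator K z *\<^sub>R h z) * (indicator K z *\<^sub>R \<bar>y z\<bar> powr r)) \<in> borel_measurable lebesgue"
      using borel_measurable_integrable[OF int] meas
      by (intro borel_measurable_times) (auto intro: measurable_completion)
    show "AE z in lebesgue. norm ((indicator K z *\<^sub>R h z) * (indicator K z *\<^sub>R \<bar>y z\<bar> powr r))
        \<le> norm (\<bar>B\<bar> * (indicator K z *\<^sub>R \<bar>y z\<bar> powr r))"
      using B by (intro AE_I2) (force simp: indicator_def abs_mult intro!: mult_right_mono)
  qed
  also have "(\<lambda>z. (indicator K z *\<^sub>R h z) * (indicator K z *\<^sub>R \<bar>y z\<bar> powr r)) =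
      (\<lambda>z. indicator (Q_dom \<infinity>) z *\<^sub>R (weight \<rho> z * \<bar>y z\<bar> powr r * radial_test m H T \<epsilon> z))"
    using K by (force simp: indicator_def h_def)
  finally show ?thesis by (simp add: set_integrable_def)
qed

text \<open>
  The terms in which \<open>H\<close> is differentiated twice and the one with \<open>n\<close> times its first derivative cancel,
  so that every remaining term carries a derivative of the cutoff.
\<close>

lemma laplacian_radial_test_bound:
  assumes m: "3 \<le> m" "real m \<le> real (m - 2) * r" and r: "1 < r" and n: "n = DIM('a::euclidean_space)"
  obtains C where "0 < C"
    "\<And>T \<epsilon> t (x::'a). 0 < T \<Longrightarrow> 0 < \<epsilon> \<Longrightarrow> \<epsilon> \<le> 1 / 2 \<Longrightarrow> x \<in> shell \<Longrightarrow>
      \<bar>laplacian (radial_test m H T \<epsilon>) (t, x)\<bar> \<le>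
      C / \<epsilon>\<^sup>2 * radial_test m H T \<epsilon> (t, x) powr (1 / r) * indicator ({T<..<2 * T} \<times> annulus \<epsilon>) (t, x)"
proof -
  obtain B c where B: "1 \<le> B" "0 < c"
    and HB: "\<And>\<tau>. 1 \<le> \<tau> \<Longrightarrow> \<tau> \<le> 4 \<Longrightarrow> H \<tau> \<le> B \<and> \<bar>H1 \<tau>\<bar> \<le> B"
    and Hc: "\<And>\<tau>. 1 \<le> \<tau> \<Longrightarrow> \<tau> \<le> 2 \<Longrightarrow> c \<le> H \<tau>"
    using profile_bounds by metis
  obtain b1 b2 where
    b: "\<And>\<epsilon>. 0 < \<epsilon> \<Longrightarrow> C2_triple UNIV (space_cut m \<epsilon>) (b1 \<epsilon>) (b2 \<epsilon>)"
    and b0: "\<And>\<epsilon> \<tau>. 0 < \<epsilon> \<Longrightarrow> \<not> (1 + \<epsilon> < \<tau> \<and> \<tau> < 1 + 2 * \<epsilon>) \<Longrightarrow> b1 \<epsilon> \<tau> = 0 \<and> b2 \<epsilon> \<tau> = 0"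
    and bb: "\<And>\<epsilon> \<tau> r. 0 < \<epsilon> \<Longrightarrow> \<epsilon> \<le> 1 \<Longrightarrow> 0 < r \<Longrightarrow> real m \<le> real (m - 2) * r \<Longrightarrow>
        \<bar>b1 \<epsilon> \<tau>\<bar> \<le> 15 * (real m)\<^sup>2 / \<epsilon>\<^sup>2 * space_cut m \<epsilon> \<tau> powr (1 / r) \<and>
        \<bar>b2 \<epsilon> \<tau>\<bar> \<le> 15 * (real m)\<^sup>2 / \<epsilon>\<^sup>2 * space_cut m \<epsilon> \<tau> powr (1 / r)"
    using space_cut_C2[OF m(1)] by metis
  define C where "C = (24 + 2 * real n) * B * (15 * (real m)\<^sup>2) * (1 / c) powr (1 / r)"
  have "0 < C" using B m by (simp add: C_def add_pos_nonneg)
  show thesis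
  proof (rule that[OF \<open>0 < C\<close>])
    fix T \<epsilon> t :: real and x :: 'a
    assume T: "0 < T" and \<epsilon>: "0 < \<epsilon>" "\<epsilon> \<le> 1 / 2" and x: "x \<in> shell"
    define \<tau> where "\<tau> = x \<bullet> x"
    have \<tau>: "1 < \<tau>" "\<tau> \<le> 4" using x by (auto simp: shell_inner \<tau>_def)
    let ?\<xi> = "space_cut m \<epsilon> \<tau>" and ?\<eta> = "time_cut m T t"
    have nz: "x \<noteq> 0" using x by (auto simp: shell_def)
    have lap: "laplacian (radial_test m H T \<epsilon>) (t, x) =
        ?\<eta> * (8 * \<tau> * H1 \<tau> * b1 \<epsilon> \<tau> + 4 * \<tau> * H \<tau> * b2 \<epsilon> \<tau> + 2 * real n * H \<tau> * b1 \<epsilon> \<tau>)"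
    proof -
      have "laplacian (radial_test m H T \<epsilon>) (t, x) = ?\<eta> *
          (4 * \<tau> * (H2 \<tau> * ?\<xi> + 2 * H1 \<tau> * b1 \<epsilon> \<tau> + H \<tau> * b2 \<epsilon> \<tau>)
           + 2 * real n * (H1 \<tau> * ?\<xi> + H \<tau> * b1 \<epsilon> \<tau>))"
        unfolding radial_test_def laplacian_tensor[OF profile_C2[OF b[OF \<epsilon>(1)]] nz]
        by (simp add: \<tau>_def n)
      also have "\<dots> = ?\<eta> * (8 * \<tau> * H1 \<tau> * b1 \<epsilon> \<tau> + 4 * \<tau> * H \<tau> * b2 \<epsilon> \<tau> + 2 * real n * H \<tau> * b1 \<epsilon> \<tau>
          + ?\<xi> * (4 * \<tau> * H2 \<tau> + 2 * real n * H1 \<tau>))"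
        by (simp add: algebra_simps)
      finally show ?thesis using harmonic[of \<tau>] \<tau> by simp
    qed
    show "\<bar>laplacian (radial_test m H T \<epsilon>) (t, x)\<bar> \<le>
      C / \<epsilon>\<^sup>2 * radial_test m H T \<epsilon> (t, x) powr (1 / r) * indicator ({T<..<2 * T} \<times> annulus \<epsilon>) (t, x)"
    proof (cases "T < t \<and> t < 2 * T \<and> 1 + \<epsilon> < \<tau> \<and> \<tau> < 1 + 2 * \<epsilon>")
      case False
      then have "?\<eta> = 0 \<or> b1 \<epsilon> \<tau> = 0 \<and> b2 \<epsilon> \<tau> = 0"
        using time_cut_eq_0[OF T m(1), of t] b0[OF \<epsilon>(1), of \<tau>] by blast
      then have "laplacian (radial_test m H T \<epsilon>) (t, x) = 0" by (auto simp: lap)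
      then show ?thesis using \<open>0 < C\<close> by (simp add: indicator_def)
    next
      case True
      let ?D = "15 * (real m)\<^sup>2 / \<epsilon>\<^sup>2 * ?\<xi> powr (1 / r)"
      have \<tau>2: "\<tau> \<le> 2" using True \<epsilon> by linarith
      have hb: "\<bar>H \<tau>\<bar> \<le> B" "\<bar>H1 \<tau>\<bar> \<le> B" using HB[of \<tau>] nonneg[of \<tau>] \<tau> by auto
      have bD: "\<bar>b1 \<epsilon> \<tau>\<bar> \<le> ?D" "\<bar>b2 \<epsilon> \<tau>\<bar> \<le> ?D" using bb[of \<epsilon> r \<tau>] \<epsilon> r m by auto
      have D: "?D \<le> 15 * (real m)\<^sup>2 / \<epsilon>\<^sup>2 * ((1 / c) powr (1 / r) * (H \<tau> * ?\<xi>) powr (1 / r))"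
      proof (rule mult_left_mono)
        have "?\<xi> \<le> 1 / c * (H \<tau> * ?\<xi>)"
          using Hc[of \<tau>] \<tau> \<tau>2 B space_cut_bounds[of m \<epsilon> \<tau>]
          by (simp add: field_simps mult_right_mono)
        then show "?\<xi> powr (1 / r) \<le> (1 / c) powr (1 / r) * (H \<tau> * ?\<xi>) powr (1 / r)"
          using space_cut_bounds[of m \<epsilon> \<tau>] r B nonneg[of \<tau>] \<tau>
          by (subst powr_mult[symmetric]) (auto intro!: powr_mono2)
      qed simp
      have "\<bar>8 * \<tau> * H1 \<tau> * b1 \<epsilon> \<tau> + 4 * \<tau> * H \<tau> * b2 \<epsilon> \<tau> + 2 * real n * H \<tau> * b1 \<epsilon> \<tau>\<bar>
          \<le> 8 * \<tau> * \<bar>H1 \<tau>\<bar> * \<bar>b1 \<epsilon> \<tau>\<bar> + 4 * \<tau> * \<bar>H \<tau>\<bar> * \<bar>b2 \<epsilon> \<tau>\<bar> + 2 * real n * \<bar>H \<tau>\<bar> * \<bar>b1 \<epsilon> \<tau>\<bar>"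
        using \<tau> by (intro order_trans[OF abs_triangle_ineq] add_mono) (auto simp: abs_mult)
      also have "\<dots> \<le> 8 * 2 * B * ?D + 4 * 2 * B * ?D + 2 * real n * B * ?D"
        using \<tau> \<tau>2 hb bD B by (intro add_mono mult_mono) auto
      also have "8 * 2 * B * s + 4 * 2 * B * s + 2 * real n * B * s = (24 + 2 * real n) * B * s" for s
        by (simp add: algebra_simps)
      finally have "\<bar>laplacian (radial_test m H T \<epsilon>) (t, x)\<bar> \<le> ?\<eta> * ((24 + 2 * real n) * B * ?D)"
        unfolding lap abs_mult by (intro mult_mono) (auto simp: time_cut_bounds abs_of_nonneg)
      also have "\<dots> \<le> ?\<eta> powr (1 / r) * ((24 + 2 * real n) * B * ?D)"
      proof (rule mult_right_mono)
        show "?\<eta> \<le> ?\<eta> powr (1 / r)"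
          using powr_mono'[of "1 / r" 1 ?\<eta>] time_cut_bounds[of m T t] r by auto
      qed (use B in auto)
      also have "\<dots> \<le> ?\<eta> powr (1 / r) * ((24 + 2 * real n) * B *
          (15 * (real m)\<^sup>2 / \<epsilon>\<^sup>2 * ((1 / c) powr (1 / r) * (H \<tau> * ?\<xi>) powr (1 / r))))"
        using B by (intro mult_left_mono D) auto
      finally have "\<bar>laplacian (radial_test m H T \<epsilon>) (t, x)\<bar> \<le>
          C / \<epsilon>\<^sup>2 * (?\<eta> powr (1 / r) * (H \<tau> * ?\<xi>) powr (1 / r))"
        by (simp add: C_def mult_ac)
      also have "?\<eta> powr (1 / r) * (H \<tau> * ?\<xi>) powr (1 / r) = radial_test m H T \<epsilon> (t, x) powr (1 / r)"
        using time_cut_bounds[of m T t] space_cut_bounds[of m \<epsilon> \<tau>] nonneg[of \<tau>] \<tau>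
        by (simp add: radial_test_def tensor_def \<tau>_def powr_mult)
      finally show ?thesis using True by (simp add: annulus_def \<tau>_def)
    qed
  qed
qed

text \<open>
  The spatial factor is not differentiated here and may vanish on the outer sphere, but being bounded
  it is dominated by a multiple of its own \<open>1 / r\<close>-th power.
\<close>

lemma time_radial_test_bound:
  assumes m: "3 \<le> m" and r: "1 < r"
    and d: "\<And>T t. 1 \<le> T \<Longrightarrow> \<bar>d T t\<bar> \<le> D / T * time_cut m T t powr (1 / r)" and D: "0 < D"
  obtains C where "0 < C"
    "\<And>T \<epsilon> t (x::'a::euclidean_space). 1 \<le> T \<Longrightarrow> x \<in> shell \<Longrightarrow>
      \<bar>tensor (d T) (\<lambda>\<tau>. H \<tau> * space_cut m \<epsilon> \<tau>) (t, x)\<bar> \<le>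
      C / T * radial_test m H T \<epsilon> (t, x) powr (1 / r) * indicator ({T<..<2 * T} \<times> shell) (t, x)"
proof -
  obtain B c where B: "1 \<le> B" "0 < c"
    and HB: "\<And>\<tau>. 1 \<le> \<tau> \<Longrightarrow> \<tau> \<le> 4 \<Longrightarrow> H \<tau> \<le> B \<and> \<bar>H1 \<tau>\<bar> \<le> B"
    and "\<And>\<tau>. 1 \<le> \<tau> \<Longrightarrow> \<tau> \<le> 2 \<Longrightarrow> c \<le> H \<tau>"
    using profile_bounds by metis
  show thesis
  proof (rule that[of "D * B"])
    show "0 < D * B" using B D by simp
  next
    fix T \<epsilon> t :: real and x :: 'a
    assume T: "1 \<le> T" and x: "x \<in> shell"
    define \<tau> where "\<tau> = x \<bullet> x"
    have \<tau>: "1 < \<tau>" "\<tau> \<le> 4" using x by (auto simp: shell_inner \<tau>_def)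
    define k where "k = H \<tau> * space_cut m \<epsilon> \<tau>"
    have k: "0 \<le> k" "k \<le> B"
    proof -
      show "0 \<le> k" using nonneg[of \<tau>] \<tau> space_cut_bounds[of m \<epsilon> \<tau>] by (simp add: k_def)
      have "k \<le> B * 1" unfolding k_def
        using nonneg[of \<tau>] HB[of \<tau>] \<tau> space_cut_bounds[of m \<epsilon> \<tau>] by (intro mult_mono) auto
      then show "k \<le> B" by simp
    qed
    have kB: "k \<le> B * k powr (1 / r)"
    proof (cases "k = 0")
      case False
      have "k = k powr (1 - 1 / r) * k powr (1 / r)" using False k by (simp add: powr_add[symmetric])
      also have "k powr (1 - 1 / r) \<le> B powr (1 - 1 / r)" using k r by (intro powr_mono2) auto
      also have "B powr (1 - 1 / r) \<le> B powr 1" using B r by (intro powr_mono) auto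
      finally show ?thesis using B by (simp add: mult_right_mono)
    qed simp
    have eq: "tensor (d T) (\<lambda>\<tau>. H \<tau> * space_cut m \<epsilon> \<tau>) (t, x) = d T t * k"
      by (simp add: tensor_def k_def \<tau>_def)
    show "\<bar>tensor (d T) (\<lambda>\<tau>. H \<tau> * space_cut m \<epsilon> \<tau>) (t, x)\<bar> \<le>
      D * B / T * radial_test m H T \<epsilon> (t, x) powr (1 / r) * indicator ({T<..<2 * T} \<times> shell) (t, x)"
    proof (cases "T < t \<and> t < 2 * T")
      case False
      then have "d T t = 0" using d[OF T, of t] T time_cut_eq_0[of T m t] m by auto
      then show ?thesis using B D T unfolding eq by (simp add: indicator_def)
    next
      case True
      have "\<bar>d T t * k\<bar> \<le> (D / T * time_cut m T t powr (1 / r)) * (B * k powr (1 / r))"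
        unfolding abs_mult using k by (intro mult_mono d[OF T]) (use kB D T in auto)
      also have "\<dots> = D * B / T * (time_cut m T t * k) powr (1 / r)"
        using time_cut_bounds[of m T t] k by (simp add: powr_mult)
      finally show ?thesis
        using True x by (simp add: eq) (simp add: radial_test_def tensor_def k_def \<tau>_def)
    qed
  qed
qed

lemma weight_ge_1:
  assumes "x \<in> shell" "0 \<le> \<rho>"
  shows "1 \<le> weight \<rho> (t, x)"
proof -
  have "(norm x - 1) powr 0 \<le> (norm x - 1) powr (- \<rho>)"
    using assms by (intro powr_mono') (auto simp: shell_def)
  then show ?thesis using assms by (auto simp: weight_def shell_def)
qed

text \<open>
  For \<open>s = norm x - 1\<close> one has \<open>2 s \<le> s (s + 2) = x \<bullet> x - 1\<close>, so \<open>s \<le> \<epsilon>\<close> in the layer.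
\<close>

lemma weight_annulus:
  assumes "x \<in> annulus \<epsilon>" "0 < \<epsilon>" "0 \<le> \<rho>"
  shows "\<epsilon> powr (- \<rho>) \<le> weight \<rho> (t, x)"
proof -
  have x: "1 < (norm x)\<^sup>2" "(norm x)\<^sup>2 < 1 + 2 * \<epsilon>"
    using assms by (auto simp: annulus_def power2_norm_eq_inner)
  then have n1: "1 < norm x" using power2_less_imp_less[of 1 "norm x"] by simp
  have "2 * (norm x - 1) \<le> (norm x + 1) * (norm x - 1)" using n1 by (intro mult_right_mono) auto
  also have "\<dots> = (norm x)\<^sup>2 - 1" by (simp add: power2_eq_square algebra_simps)
  also have "\<dots> \<le> 2 * \<epsilon>" using x(2) by simp
  finally have "norm x - 1 \<le> \<epsilon>" by simp
  then show ?thesis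
    using n1 assms by (simp add: weight_def powr_minus powr_mono2 le_imp_inverse_le)
qed

section \<open>The basic integral estimate\<close>

text \<open>
  This bounds the right-hand side of a weak inequality tested with a radial test function. The Laplacian
  contributes, by Young's inequality with parameter \<open>l\<close> times the weight, an energy restricted to the
  layer and a remainder. The remainder is the volume \<open>T * \<epsilon>\<close> of the layer in space-time times
  \<open>(\<epsilon> powr (-2)) powr (r / (r - 1))\<close> from the second derivatives and \<open>\<epsilon> powr (\<rho> / (r - 1))\<close>
  from the weight. The time derivative contributes the full energy with the small factor \<open>1 / T\<close>,
  and a constant.
\<close>

lemma test_estimate:
  fixes y :: "real \<times> 'a::euclidean_space \<Rightarrow> real"
  assumes y: "Lp_loc r (Q_dom \<infinity>) y" and r: "1 < r" and \<rho>: "0 \<le> \<rho>" and n: "n = DIM('a)"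
    and m: "3 \<le> m" "real m \<le> real (m - 2) * r"
    and d: "\<And>T t. 1 \<le> T \<Longrightarrow> \<bar>d T t\<bar> \<le> D / T * time_cut m T t powr (1 / r)" "0 < D"
  obtains C where "0 < C"
    "\<And>T \<epsilon> l. 1 \<le> T \<Longrightarrow> 0 < \<epsilon> \<Longrightarrow> \<epsilon> \<le> 1 / 2 \<Longrightarrow> 0 < l \<Longrightarrow>
      int_Q \<infinity> (\<lambda>z. y z * tensor (d T) (\<lambda>\<tau>. H \<tau> * space_cut m \<epsilon> \<tau>) z)
        - int_Q \<infinity> (\<lambda>z. y z * laplacian (radial_test m H T \<epsilon>) z)
      \<le> l * int_Q \<infinity> (\<lambda>z. indicator (annulus \<epsilon>) (snd z) *
              (weight \<rho> z * \<bar>y z\<bar> powr r * radial_test m H T \<epsilon> z))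
        + T * (C * l powr (- 1 / (r - 1)) * \<epsilon> powr ((\<rho> - 1 - r) / (r - 1)))
        + C / T * int_Q \<infinity> (\<lambda>z. weight \<rho> z * \<bar>y z\<bar> powr r * radial_test m H T \<epsilon> z) + C"
proof -
  obtain C1 where C1: "0 < C1"
    "\<And>T \<epsilon> t (x::'a). 0 < T \<Longrightarrow> 0 < \<epsilon> \<Longrightarrow> \<epsilon> \<le> 1 / 2 \<Longrightarrow> x \<in> shell \<Longrightarrow>
      \<bar>laplacian (radial_test m H T \<epsilon>) (t, x)\<bar> \<le>
      C1 / \<epsilon>\<^sup>2 * radial_test m H T \<epsilon> (t, x) powr (1 / r) * indicator ({T<..<2 * T} \<times> annulus \<epsilon>) (t, x)"
    using laplacian_radial_test_bound[OF m r n] by blast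
  obtain C2 where C2: "0 < C2"
    "\<And>T \<epsilon> t (x::'a). 1 \<le> T \<Longrightarrow> x \<in> shell \<Longrightarrow>
      \<bar>tensor (d T) (\<lambda>\<tau>. H \<tau> * space_cut m \<epsilon> \<tau>) (t, x)\<bar> \<le>
      C2 / T * radial_test m H T \<epsilon> (t, x) powr (1 / r) * indicator ({T<..<2 * T} \<times> shell) (t, x)"
    using time_radial_test_bound[OF m(1) r d] by blast
  define V where "V = unit_ball_vol (real DIM('a)) * real DIM('a) * 2 ^ DIM('a)"
  have V: "0 \<le> V" by (simp add: V_def)
  define W where "W = measure lborel (shell :: 'a set)"
  have W: "0 \<le> W" by (simp add: W_def)
  define C3 where "C3 = C1 powr (r / (r - 1)) * V"
  define C where "C = C2 + C2 * W + C3"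
  show thesis
  proof (rule that[of C])
    show "0 < C" using C2 V W by (simp add: C_def C3_def add_pos_nonneg)
  next
    fix T \<epsilon> l :: real
    assume T: "1 \<le> T" and \<epsilon>: "0 < \<epsilon>" "\<epsilon> \<le> 1 / 2" and l: "0 < l"
    have T0: "0 < T" using T by simp
    define \<phi> :: "real \<times> 'a \<Rightarrow> real" where "\<phi> = radial_test m H T \<epsilon>"
    have \<phi>: "0 \<le> \<phi> z" if "z \<in> Q_dom \<infinity>" for z using radial_test_nonneg[OF that] by (simp add: \<phi>_def)
    define P where "P z = weight \<rho> z * \<bar>y z\<bar> powr r * \<phi> z" for z
    have w0: "0 \<le> weight \<rho> z" for z :: "real \<times> 'a" by (simp add: weight_def case_prod_unfold)
    have P0: "0 \<le> P z" if "z \<in> Q_dom \<infinity>" for z using \<phi>[OF that] w0 by (simp add: P_def)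
    have Pint: "set_integrable lebesgue (Q_dom \<infinity>) P"
      unfolding P_def \<phi>_def by (rule weighted_integrable[OF y T0 \<epsilon>(1) m(1)])
    have xr: "(\<bar>y z\<bar> * \<phi> z powr (1 / r)) powr r = \<bar>y z\<bar> powr r * \<phi> z" if "z \<in> Q_dom \<infinity>" for z
      using \<phi>[OF that] r by (simp add: powr_mult powr_powr)
    have I1: "int_Q \<infinity> (\<lambda>z. y z * tensor (d T) (\<lambda>\<tau>. H \<tau> * space_cut m \<epsilon> \<tau>) z)
        \<le> C2 / T * int_Q \<infinity> P + C2 / T * ((2 * T - T) * W)"
      unfolding W_def
    proof (rule int_Q_le[OF Pint P0])
      fix z :: "real \<times> 'a" assume z: "z \<in> Q_dom \<infinity>"
      obtain t x where tx: "z = (t, x)" by (cases z)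
      have x: "x \<in> shell" using z by (simp add: tx Q_dom_infinity)
      let ?B = "indicator ({T<..<2 * T} \<times> shell) z :: real"
      let ?X = "\<bar>y z\<bar> * \<phi> z powr (1 / r)"
      \<comment> \<open>The weight is at least 1 on the shell, so it may be inserted for free.\<close>
      have X: "?X \<le> P z + 1"
      proof -
        have "?X \<le> ?X powr r + 1"
        proof (cases "?X \<le> 1")
          case True
          then show ?thesis by (smt (verit) powr_ge_zero)
        next
          case False
          then have "?X powr 1 \<le> ?X powr r" using r by (intro powr_mono) auto
          then show ?thesis using False by simp
        qed
        also have "?X powr r = 1 * (\<bar>y z\<bar> powr r * \<phi> z)" using xr[OF z] by simp
        also have "\<dots> \<le> weight \<rho> z * (\<bar>y z\<bar> powr r * \<phi> z)"
          using weight_ge_1[OF x \<rho>] \<phi>[OF z] unfolding tx by (intro mult_right_mono) auto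
        finally show ?thesis by (simp add: P_def mult.assoc)
      qed
      have "y z * tensor (d T) (\<lambda>\<tau>. H \<tau> * space_cut m \<epsilon> \<tau>) z
          \<le> \<bar>y z\<bar> * \<bar>tensor (d T) (\<lambda>\<tau>. H \<tau> * space_cut m \<epsilon> \<tau>) z\<bar>"
        by (metis abs_ge_self abs_mult)
      also have "\<dots> \<le> \<bar>y z\<bar> * (C2 / T * \<phi> z powr (1 / r) * ?B)"
        using C2(2)[OF T x, of \<epsilon> t] by (intro mult_left_mono) (auto simp: tx \<phi>_def)
      also have "\<dots> = C2 / T * (?X * ?B)" by simp
      also have "\<dots> \<le> C2 / T * (P z + ?B)"
        using C2(1) T X P0[OF z] by (intro mult_left_mono) (auto simp: indicator_def)
      finally show "y z * tensor (d T) (\<lambda>\<tau>. H \<tau> * space_cut m \<epsilon> \<tau>) z \<le> C2 / T * P z + C2 / T * ?B"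
        by (simp add: algebra_simps)
    qed (use T C2(1) in auto)
    define E where "E = l powr (- 1 / (r - 1)) * (C1 powr (r / (r - 1)) * \<epsilon> powr ((\<rho> - 2 * r) / (r - 1)))"
    define A where "A z = indicator (annulus \<epsilon>) (snd z) * P z" for z
    have "{z::real \<times> 'a. snd z \<in> annulus \<epsilon>} = UNIV \<times> annulus \<epsilon>" by auto
    then have ann: "{z::real \<times> 'a. snd z \<in> annulus \<epsilon>} \<in> sets lebesgue"
      by (simp add: borel_Times)
    have Aint: "set_integrable lebesgue (Q_dom \<infinity>) A"
    proof -
      have "integrable lebesgue (\<lambda>z. indicator {z. snd z \<in> annulus \<epsilon>} z *\<^sub>R (indicator (Q_dom \<infinity>) z *\<^sub>R P z))"
        using Pint ann unfolding set_integrable_def by (rule integrable_mult_indicator[rotated])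
      then show ?thesis
        unfolding set_integrable_def
        by (rule back_subst[of "integrable lebesgue"]) (auto simp: A_def indicator_def)
    qed
    have A0: "0 \<le> A z" if "z \<in> Q_dom \<infinity>" for z using P0[OF that] by (simp add: A_def)
    have I2: "int_Q \<infinity> (\<lambda>z. - (y z * laplacian (radial_test m H T \<epsilon>) z))
        \<le> l * int_Q \<infinity> A + E * ((2 * T - T) * measure lborel (annulus \<epsilon> :: 'a set))"
    proof (rule int_Q_le[OF Aint A0])
      show "(annulus \<epsilon> :: 'a set) \<subseteq> shell" using \<epsilon> by (intro annulus_subset_shell) auto
      fix z :: "real \<times> 'a" assume z: "z \<in> Q_dom \<infinity>"
      obtain t x where tx: "z = (t, x)" by (cases z)
      have x: "x \<in> shell" using z by (simp add: tx Q_dom_infinity)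
      let ?B = "indicator ({T<..<2 * T} \<times> annulus \<epsilon>) z :: real"
      let ?X = "\<bar>y z\<bar> * \<phi> z powr (1 / r)"
      have "- (y z * laplacian (radial_test m H T \<epsilon>) z) \<le> \<bar>y z\<bar> * \<bar>laplacian (radial_test m H T \<epsilon>) z\<bar>"
        by (metis abs_ge_minus_self abs_mult)
      also have "\<dots> \<le> \<bar>y z\<bar> * (C1 / \<epsilon>\<^sup>2 * \<phi> z powr (1 / r) * ?B)"
        using C1(2)[OF T0 \<epsilon> x, of t] by (intro mult_left_mono) (auto simp: tx \<phi>_def)
      also have "\<dots> = (?X * (C1 / \<epsilon>\<^sup>2)) * ?B" by simp
      also have "\<dots> \<le> l * A z + E * ?B"
      proof (cases "z \<in> {T<..<2 * T} \<times> annulus \<epsilon>")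
        case False
        then show ?thesis using A0[OF z] l by simp
      next
        case True
        \<comment> \<open>In the layer \<open>\<epsilon> powr (- \<rho>)\<close> is a lower bound for the weight.\<close>
        have "?X * (C1 / \<epsilon>\<^sup>2) \<le> (l * \<epsilon> powr (- \<rho>)) * ?X powr r
            + (l * \<epsilon> powr (- \<rho>)) powr (- 1 / (r - 1)) * (C1 / \<epsilon>\<^sup>2) powr (r / (r - 1))"
          using l \<epsilon> r C1(1) by (intro weighted_young) auto
        also have "(l * \<epsilon> powr (- \<rho>)) * ?X powr r \<le> l * A z"
        proof -
          have "\<epsilon> powr (- \<rho>) * (\<bar>y z\<bar> powr r * \<phi> z) \<le> weight \<rho> z * (\<bar>y z\<bar> powr r * \<phi> z)"
            using weight_annulus[of x \<epsilon> \<rho> t] True \<epsilon> \<rho> \<phi>[OF z] unfolding tx by (intro mult_right_mono) auto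
          then show ?thesis using True l xr[OF z] by (simp add: A_def P_def mult.assoc tx)
        qed
        also have "(l * \<epsilon> powr (- \<rho>)) powr (- 1 / (r - 1)) * (C1 / \<epsilon>\<^sup>2) powr (r / (r - 1)) = E"
        proof -
          have e1: "(l * \<epsilon> powr (- \<rho>)) powr (- 1 / (r - 1)) =
              l powr (- 1 / (r - 1)) * \<epsilon> powr (\<rho> / (r - 1))"
            using l by (simp add: powr_mult powr_powr)
          have "C1 / \<epsilon>\<^sup>2 = C1 * \<epsilon> powr (- 2)" using \<epsilon> by (simp add: powr_neg_numeral)
          then have e2: "(C1 / \<epsilon>\<^sup>2) powr (r / (r - 1)) = C1 powr (r / (r - 1)) * \<epsilon> powr (- 2 * r / (r - 1))"
            using C1(1) by (simp add: powr_mult powr_powr)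
          have e3: "\<epsilon> powr ((\<rho> - 2 * r) / (r - 1)) = \<epsilon> powr (\<rho> / (r - 1)) * \<epsilon> powr (- 2 * r / (r - 1))"
            by (simp add: powr_add[symmetric] diff_divide_distrib)
          show ?thesis unfolding e1 e2 e3 E_def by (simp only: mult_ac)
        qed
        finally show ?thesis using True by simp
      qed
      finally show "- (y z * laplacian (radial_test m H T \<epsilon>) z) \<le> l * A z + E * ?B" .
    qed (use T l in \<open>auto simp: E_def\<close>)
    have E0: "0 \<le> E" by (simp add: E_def)
    have "E * ((2 * T - T) * measure lborel (annulus \<epsilon> :: 'a set)) \<le> E * (T * (V * \<epsilon>))"
      using measure_annulus_le[where 'a = 'a, of \<epsilon>] \<epsilon> T E0 unfolding V_def by (intro mult_left_mono) auto
    also have "\<dots> = T * (C3 * l powr (- 1 / (r - 1)) * \<epsilon> powr ((\<rho> - 1 - r) / (r - 1)))"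
    proof -
      have "\<epsilon> powr ((\<rho> - 2 * r) / (r - 1)) * \<epsilon> = \<epsilon> powr ((\<rho> - 2 * r) / (r - 1) + 1)"
        using \<epsilon> by (simp add: powr_add)
      also have "(\<rho> - 2 * r) / (r - 1) + 1 = (\<rho> - 1 - r) / (r - 1)" using r by (simp add: field_simps)
      finally have "\<epsilon> powr ((\<rho> - 1 - r) / (r - 1)) = \<epsilon> powr ((\<rho> - 2 * r) / (r - 1)) * \<epsilon>" ..
      then show ?thesis by (simp add: E_def C3_def)
    qed
    also have "\<dots> \<le> T * (C * l powr (- 1 / (r - 1)) * \<epsilon> powr ((\<rho> - 1 - r) / (r - 1)))"
      using T C2(1) W by (intro mult_left_mono mult_right_mono) (auto simp: C_def)
    finally have I3: "E * ((2 * T - T) * measure lborel (annulus \<epsilon> :: 'a set))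
      \<le> T * (C * l powr (- 1 / (r - 1)) * \<epsilon> powr ((\<rho> - 1 - r) / (r - 1)))" .
    have "0 \<le> int_Q \<infinity> P"
      unfolding int_Q_def set_lebesgue_integral_def
      by (rule Bochner_Integration.integral_nonneg) (use P0 in \<open>auto simp: indicator_def\<close>)
    then have "C2 / T * int_Q \<infinity> P \<le> C / T * int_Q \<infinity> P"
      using T C2(1) V W by (intro mult_right_mono divide_right_mono) (auto simp: C_def C3_def)
    moreover have "C2 / T * ((2 * T - T) * W) \<le> C"
      using T C2(1) V by (simp add: C_def C3_def)
    moreover have "int_Q \<infinity> (\<lambda>z. - (y z * laplacian (radial_test m H T \<epsilon>) z)) =
        - int_Q \<infinity> (\<lambda>z. y z * laplacian (radial_test m H T \<epsilon>) z)"
      by (simp add: int_Q_def set_lebesgue_integral_def)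
    ultimately have "int_Q \<infinity> (\<lambda>z. y z * tensor (d T) (\<lambda>\<tau>. H \<tau> * space_cut m \<epsilon> \<tau>) z)
        - int_Q \<infinity> (\<lambda>z. y z * laplacian (radial_test m H T \<epsilon>) z)
      \<le> l * int_Q \<infinity> A + T * (C * l powr (- 1 / (r - 1)) * \<epsilon> powr ((\<rho> - 1 - r) / (r - 1)))
        + C / T * int_Q \<infinity> P + C"
      using I1 I2 I3 by linarith
    then show "int_Q \<infinity> (\<lambda>z. y z * tensor (d T) (\<lambda>\<tau>. H \<tau> * space_cut m \<epsilon> \<tau>) z)
        - int_Q \<infinity> (\<lambda>z. y z * laplacian (radial_test m H T \<epsilon>) z)
      \<le> l * int_Q \<infinity> (\<lambda>z. indicator (annulus \<epsilon>) (snd z) *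
              (weight \<rho> z * \<bar>y z\<bar> powr r * radial_test m H T \<epsilon> z))
        + T * (C * l powr (- 1 / (r - 1)) * \<epsilon> powr ((\<rho> - 1 - r) / (r - 1)))
        + C / T * int_Q \<infinity> (\<lambda>z. weight \<rho> z * \<bar>y z\<bar> powr r * radial_test m H T \<epsilon> z) + C"
      by (simp add: A_def[abs_def] P_def[abs_def] \<phi>_def)
  qed
qed

end

section \<open>The critical iteration\<close>

lemma powr_constant_small:
  fixes C \<eta> r :: real
  assumes "0 < C" "0 < \<eta>" "1 < r"
  obtains l where "0 < l" "C * l powr (- 1 / (r - 1)) \<le> \<eta>"
proof
  show "0 < (C / \<eta>) powr (r - 1)" using assms by simp
  have "((C / \<eta>) powr (r - 1)) powr (- 1 / (r - 1)) = \<eta> / C"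
    using assms by (simp add: powr_powr powr_neg_one)
  then show "C * ((C / \<eta>) powr (r - 1)) powr (- 1 / (r - 1)) \<le> \<eta>" using assms by simp
qed

text \<open>
  The numerical core. Here \<open>a\<close> and \<open>b\<close> stand for the energies of the two components, averaged over time,
  at cutoff scale \<open>e k\<close>, and \<open>D\<close> for the part of \<open>a\<close> in the transition layer. Choosing \<open>l\<close>
  proportional to \<open>e k powr \<delta>\<close> in the first inequality and to \<open>e k powr (- \<delta>)\<close> in the second, and
  measuring \<open>b\<close> in the unit \<open>e k powr (- \<delta>)\<close>, removes all powers of \<open>e k\<close>: this is the meaning of
  criticality. Feeding the second inequality into the first with \<open>D \<le> a\<close> gives a bound \<open>a \<le> M\<close>
  independent of the scale. As the layer energies \<open>D\<close> are bounded by telescoping differences of \<open>a\<close>,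
  one of \<open>K\<close> consecutive layers carries at most \<open>2 M / K\<close>, and for that layer the same two
  inequalities push \<open>a + G\<close> below \<open>G\<close>.
\<close>

lemma critical_iteration:
  fixes a b D :: "real \<Rightarrow> nat \<Rightarrow> real" and e :: "nat \<Rightarrow> real"
  assumes C: "0 < C" "0 < C'" and G: "0 < G" and pq: "1 < p" "1 < q" and \<delta>: "0 \<le> \<delta>"
    and e: "\<And>k. 0 < e k" "\<And>k. e k \<le> 1"
    and pos: "\<And>T k. 1 \<le> T \<Longrightarrow> 0 \<le> a T k" "\<And>T k. 1 \<le> T \<Longrightarrow> 0 \<le> b T k"
    and D: "\<And>T k. 1 \<le> T \<Longrightarrow> D T k \<le> a T k"
      "\<And>T k. 1 \<le> T \<Longrightarrow> D T (Suc k) \<le> a T (Suc (Suc k)) - a T k"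
    and ineq1: "\<And>T k l. 1 \<le> T \<Longrightarrow> 0 < l \<Longrightarrow>
      a T k + G \<le> l * b T k + C * l powr (- 1 / (q - 1)) * e k powr (\<delta> / (q - 1)) + C / T * (b T k + 1)"
    and ineq2: "\<And>T k l. 1 \<le> T \<Longrightarrow> 0 < l \<Longrightarrow>
      b T k \<le> l * D T k + C' * l powr (- 1 / (p - 1)) * e k powr (- p * \<delta> / (p - 1)) + C' / T * (a T k + 1)"
  shows False
proof -
  have scaled: "a T k + G \<le> l * (e k powr \<delta> * b T k) + C * l powr (- 1 / (q - 1))
        + \<kappa> * (e k powr \<delta> * b T k) + \<kappa>" (is ?A)
      "e k powr \<delta> * b T k \<le> l * D T k + C' * l powr (- 1 / (p - 1)) + \<kappa> * (a T k + 1)" (is ?B)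
    if T: "1 \<le> T" and l: "0 < l" and \<kappa>: "(C + C') / T \<le> \<kappa> * e k powr \<delta>" for T k l \<kappa>
  proof -
    have ed: "0 < e k powr \<delta>" "e k powr \<delta> \<le> 1"
      using e[of k] \<delta> by (auto intro: powr_le1)
    have "0 < (C + C') / T" using C T by simp
    then have "0 < \<kappa> * e k powr \<delta>" using \<kappa> by (rule less_le_trans)
    then have \<kappa>0: "0 < \<kappa>" using ed by (simp add: zero_less_mult_iff)
    have CT: "C / T \<le> \<kappa> * e k powr \<delta>" "C' / T \<le> \<kappa> * e k powr \<delta>"
      using \<kappa> C T by (auto simp: field_simps)
    have \<kappa>1: "\<kappa> * e k powr \<delta> \<le> \<kappa>" using ed \<kappa>0 by (simp add: mult_le_cancel_left1)
    have "a T k + G \<le> (l * e k powr \<delta>) * b T k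
        + C * (l * e k powr \<delta>) powr (- 1 / (q - 1)) * e k powr (\<delta> / (q - 1)) + C / T * (b T k + 1)"
      using l ed by (intro ineq1 T) auto
    also have "C * (l * e k powr \<delta>) powr (- 1 / (q - 1)) * e k powr (\<delta> / (q - 1)) = C * l powr (- 1 / (q - 1))"
    proof -
      have "(l * e k powr \<delta>) powr (- 1 / (q - 1)) * e k powr (\<delta> / (q - 1))
          = l powr (- 1 / (q - 1)) * (e k powr (- (\<delta> / (q - 1))) * e k powr (\<delta> / (q - 1)))"
        using l by (simp add: powr_mult powr_powr)
      also have "e k powr (- (\<delta> / (q - 1))) * e k powr (\<delta> / (q - 1)) = 1"
        using e(1)[of k] by (subst powr_add[symmetric]) simp
      finally show ?thesis by simp
    qed
    also have "C / T * (b T k + 1) \<le> \<kappa> * (e k powr \<delta> * b T k) + \<kappa>"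
    proof -
      have "C / T * (b T k + 1) \<le> \<kappa> * e k powr \<delta> * (b T k + 1)"
        using pos(2)[OF T, of k] by (intro mult_right_mono CT) auto
      then show ?thesis using \<kappa>1 by (simp add: algebra_simps)
    qed
    finally show ?A by (simp add: algebra_simps)
    have "b T k \<le> (l / e k powr \<delta>) * D T k
        + C' * (l / e k powr \<delta>) powr (- 1 / (p - 1)) * e k powr (- p * \<delta> / (p - 1)) + C' / T * (a T k + 1)"
      using l ed by (intro ineq2 T) auto
    then have "e k powr \<delta> * b T k \<le> e k powr \<delta> * ((l / e k powr \<delta>) * D T k
        + C' * (l / e k powr \<delta>) powr (- 1 / (p - 1)) * e k powr (- p * \<delta> / (p - 1)) + C' / T * (a T k + 1))"
      using ed by (intro mult_left_mono) auto
    also have "\<dots> = l * D T k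
        + C' * (e k powr \<delta> * (l / e k powr \<delta>) powr (- 1 / (p - 1)) * e k powr (- p * \<delta> / (p - 1)))
        + e k powr \<delta> * (C' / T * (a T k + 1))"
      using ed by (simp add: algebra_simps)
    also have "e k powr \<delta> * (l / e k powr \<delta>) powr (- 1 / (p - 1)) * e k powr (- p * \<delta> / (p - 1))
        = l powr (- 1 / (p - 1))"
    proof -
      have "l / e k powr \<delta> = l * e k powr (- \<delta>)" by (simp add: powr_minus divide_inverse)
      then have "(l / e k powr \<delta>) powr (- 1 / (p - 1)) = l powr (- 1 / (p - 1)) * e k powr (\<delta> / (p - 1))"
        using l by (simp add: powr_mult powr_powr)
      then have "e k powr \<delta> * (l / e k powr \<delta>) powr (- 1 / (p - 1)) * e k powr (- p * \<delta> / (p - 1))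
          = l powr (- 1 / (p - 1)) * (e k powr \<delta> * e k powr (\<delta> / (p - 1)) * e k powr (- p * \<delta> / (p - 1)))"
        by (simp only: mult_ac)
      also have "e k powr \<delta> * e k powr (\<delta> / (p - 1)) * e k powr (- p * \<delta> / (p - 1))
          = e k powr (\<delta> + \<delta> / (p - 1) + (- p * \<delta> / (p - 1)))"
        by (simp only: powr_add)
      also have "\<delta> + \<delta> / (p - 1) + (- p * \<delta> / (p - 1)) = 0" using pq by (simp add: field_simps)
      finally show ?thesis using e(1)[of k] by simp
    qed
    also have "e k powr \<delta> * (C' / T * (a T k + 1)) \<le> \<kappa> * (a T k + 1)"
    proof -
      have "e k powr \<delta> * (C' / T * (a T k + 1)) \<le> 1 * (\<kappa> * (a T k + 1))"
        using ed CT(2) \<kappa>1 C T pos(1)[OF T, of k] by (intro mult_mono mult_right_mono) auto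
      then show ?thesis by simp
    qed
    finally show ?B by simp
  qed
  \<comment> \<open>This is what the two scaled inequalities with \<open>l = 1\<close> and \<open>l = 1 / 8\<close>, respectively, give as a bound for \<open>a\<close>.\<close>
  define M where "M = 2 * (C + 2 * (C' * (1 / 8) powr (- 1 / (p - 1))) + 1)"
  have M: "0 < M" using C by (simp add: M_def add_pos_nonneg)
  \<comment> \<open>The constants are chosen in the order \<open>l\<close>, \<open>\<mu>\<close>, \<open>\<kappa>\<close>, \<open>K\<close>, \<open>T\<close>, each depending on the previous ones.\<close>
  obtain l where l: "0 < l" "C * l powr (- 1 / (q - 1)) \<le> G / 4"
    using powr_constant_small[OF C(1) _ pq(2), of "G / 4"] G by auto
  define X where "X = l + 1"
  have X: "1 < X" using l by (simp add: X_def)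
  obtain \<mu> where \<mu>: "0 < \<mu>" "C' * \<mu> powr (- 1 / (p - 1)) \<le> G / (8 * X)"
    using powr_constant_small[OF C(2) _ pq(1), of "G / (8 * X)"] G X by auto
  define \<kappa> where "\<kappa> = min (1 / 8) (G / (8 * X * (M + 1)))"
  have \<kappa>: "0 < \<kappa>" "\<kappa> \<le> 1 / 8" "\<kappa> * (M + 1) \<le> G / (8 * X)" "\<kappa> \<le> G / 8"
  proof -
    show \<kappa>0: "0 < \<kappa>" using G X M by (auto simp: \<kappa>_def)
    show "\<kappa> \<le> 1 / 8" unfolding \<kappa>_def by (rule min.cobounded1)
    have "\<kappa> \<le> G / (8 * X * (M + 1))" by (simp add: \<kappa>_def)
    then have "\<kappa> * (M + 1) \<le> G / (8 * X * (M + 1)) * (M + 1)"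
      using M by (intro mult_right_mono) auto
    also have "\<dots> = G / (8 * X)" using M by simp
    finally show k: "\<kappa> * (M + 1) \<le> G / (8 * X)" .
    have "\<kappa> * 1 \<le> \<kappa> * (M + 1)" using \<kappa>0 M by (intro mult_left_mono) auto
    moreover have "G / (8 * X) \<le> G / 8" using G X by (simp add: field_simps)
    ultimately show "\<kappa> \<le> G / 8" using k by linarith
  qed
  obtain K :: nat where K: "2 * M * \<mu> * (8 * X) / G < real K" using reals_Archimedean2 by blast
  have "0 < 2 * M * \<mu> * (8 * X) / G" using M \<mu> X G by simp
  then have K0: "0 < real K" using K by linarith
  have K1: "\<mu> * (2 * M / real K) \<le> G / (8 * X)"
    using K K0 G X by (simp add: field_simps)
  \<comment> \<open>All time contributions at the scales \<open>0, ..., K + 1\<close> have to be small for one and the same \<open>T\<close>.\<close>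
  define T where "T = 1 + (\<Sum>k\<le>Suc K. (C + C') / (\<kappa> * e k powr \<delta>))"
  have term_pos: "0 < (C + C') / (\<kappa> * e k powr \<delta>)" for k
    using C \<kappa> e(1)[of k] by simp
  have T: "1 \<le> T" unfolding T_def using term_pos by (simp add: sum_nonneg less_imp_le)
  have small: "(C + C') / T \<le> \<kappa> * e k powr \<delta>" if "k \<le> Suc K" for k
  proof -
    have "(C + C') / (\<kappa> * e k powr \<delta>) \<le> (\<Sum>k\<le>Suc K. (C + C') / (\<kappa> * e k powr \<delta>))"
      using term_pos that by (intro member_le_sum) (auto intro: less_imp_le)
    then have "(C + C') / (\<kappa> * e k powr \<delta>) \<le> T" by (simp add: T_def)
    then show ?thesis using T \<kappa> e(1)[of k] by (simp add: field_simps)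
  qed
  have bound: "a T k \<le> M" if "k \<le> Suc K" for k
  proof -
    let ?B = "e k powr \<delta> * b T k"
    have B0: "0 \<le> ?B" using pos(2)[OF T] by simp
    have 1: "a T k + G \<le> ?B + C + \<kappa> * ?B + \<kappa>"
      using scaled(1)[where T = T and l = 1 and k = k and \<kappa> = \<kappa>, OF T] small[OF that] by simp
    have 2: "?B \<le> a T k / 8 + C' * (1 / 8) powr (- 1 / (p - 1)) + \<kappa> * (a T k + 1)"
      using scaled(2)[where T = T and l = "1 / 8" and k = k and \<kappa> = \<kappa>, OF T] small[OF that] D(1)[OF T, of k] by simp
    have 3: "\<kappa> * ?B \<le> 1 / 8 * ?B" using B0 \<kappa> by (intro mult_right_mono) auto
    have 4: "\<kappa> * (a T k + 1) \<le> 1 / 8 * (a T k + 1)"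
      using pos(1)[OF T, of k] \<kappa> by (intro mult_right_mono) auto
    define c where "c = C' * (1 / 8) powr (- 1 / (p - 1))"
    have c0: "0 \<le> c" using C by (simp add: c_def)
    have lin: "x \<le> 2 * (C + 2 * c + 1)" if "x \<le> 9 / 8 * B + C + 1 / 8" "B \<le> x / 4 + c + 1 / 8" "0 \<le> x"
      for x B :: real using that c0 C by (simp add: field_simps)
    have "a T k \<le> 9 / 8 * ?B + C + 1 / 8" using 1 3 \<kappa> G by linarith
    moreover have "?B \<le> a T k / 4 + c + 1 / 8" using 2 4 by (simp add: c_def)
    ultimately have "a T k \<le> 2 * (C + 2 * c + 1)" using pos(1)[OF T, of k] by (rule lin)
    then show ?thesis by (simp add: M_def c_def)
  qed
  have telescope: "(\<Sum>j<k. a T (Suc (Suc j)) - a T j) = a T (Suc k) + a T k - a T 1 - a T 0" for k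
    by (induction k) auto
  have "\<exists>j<K. a T (Suc (Suc j)) - a T j \<le> 2 * M / real K"
  proof (rule ccontr)
    assume "\<not> ?thesis"
    then have "(\<Sum>j<K. 2 * M / real K) < (\<Sum>j<K. a T (Suc (Suc j)) - a T j)"
      using K0 by (intro sum_strict_mono) (auto simp: not_le)
    also have "\<dots> = a T (Suc K) + a T K - a T 1 - a T 0"
      by (rule telescope)
    also have "\<dots> \<le> 2 * M"
      using bound[of K] bound[of "Suc K"] pos(1)[OF T, of 0] pos(1)[OF T, of 1] by simp
    finally show False using K0 by simp
  qed
  then obtain j where j: "j < K" "a T (Suc (Suc j)) - a T j \<le> 2 * M / real K" by blast
  let ?k = "Suc j"
  let ?B = "e ?k powr \<delta> * b T ?k"
  have k: "?k \<le> Suc K" using j by simp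
  have B0: "0 \<le> ?B" using pos(2)[OF T] by simp
  have "?B \<le> \<mu> * D T ?k + C' * \<mu> powr (- 1 / (p - 1)) + \<kappa> * (a T ?k + 1)"
    by (rule scaled(2)[OF T \<mu>(1) small[OF k]])
  moreover have "\<mu> * D T ?k \<le> \<mu> * (2 * M / real K)"
    using D(2)[OF T, of j] j \<mu> by (intro mult_left_mono) auto
  moreover have "\<kappa> * (a T ?k + 1) \<le> \<kappa> * (M + 1)"
    using bound[OF k] \<kappa> by (intro mult_left_mono) auto
  ultimately have "?B \<le> 3 * (G / (8 * X))" using K1 \<mu>(2) \<kappa>(3) by linarith
  then have XB: "X * ?B \<le> 3 / 8 * G" using X by (simp add: field_simps)
  have "a T ?k + G \<le> l * ?B + C * l powr (- 1 / (q - 1)) + \<kappa> * ?B + \<kappa>"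
    by (rule scaled(1)[OF T l(1) small[OF k]])
  moreover have "\<kappa> * ?B \<le> 1 * ?B" using B0 \<kappa> by (intro mult_right_mono) auto
  ultimately have "a T ?k + G \<le> X * ?B + G / 4 + G / 8"
    using l(2) \<kappa>(4) by (simp add: X_def algebra_simps)
  then show False using XB pos(1)[OF T, of ?k] G by linarith
qed

text \<open>
  In the layer at scale \<open>\<epsilon>\<close> the cutoff at scale \<open>\<epsilon> / 2\<close> is already 1 and the one at scale \<open>2 \<epsilon>\<close>
  is still 0. This converts the energy of a layer into a difference of energies at neighbouring dyadic
  scales.
\<close>

lemma space_cut_step:
  assumes "0 < \<epsilon>" "3 \<le> m"
  shows "(if 1 + \<epsilon> < \<tau> \<and> \<tau> < 1 + 2 * \<epsilon> then space_cut m \<epsilon> \<tau> else 0)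
    \<le> space_cut m (\<epsilon> / 2) \<tau> - space_cut m (2 * \<epsilon>) \<tau>"
proof (cases "1 + \<epsilon> < \<tau>")
  case True
  then have "space_cut m (\<epsilon> / 2) \<tau> = 1" using assms by (intro space_cut_eq_1) auto
  moreover have "space_cut m (2 * \<epsilon>) \<tau> = 0" if "\<tau> < 1 + 2 * \<epsilon>"
    using assms that by (intro space_cut_eq_0) auto
  ultimately show ?thesis
    using space_cut_bounds[of m \<epsilon> \<tau>] space_cut_bounds[of m "2 * \<epsilon>" \<tau>] by auto
next
  case False
  then have "space_cut m (2 * \<epsilon>) \<tau> = 0" using assms by (intro space_cut_eq_0) auto
  then show ?thesis using False space_cut_bounds[of m "\<epsilon> / 2" \<tau>] by auto
qed

context radial_harmonic
begin

text \<open>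
  For \<open>p \<ge> q\<close> the critical exponent satisfies \<open>\<rho> - 1 - q = \<delta>\<close> and \<open>\<rho> - 1 - p = - p \<delta>\<close> with
  \<open>\<delta> = (p - q) / (p + 1) \<ge> 0\<close>, which are exactly the powers for which the two estimates balance
  in the iteration.
\<close>

lemma no_critical_pair:
  fixes u v :: "real \<times> 'a::euclidean_space \<Rightarrow> real"
  assumes pq: "q \<le> p" "1 < q" and \<rho>: "\<rho> = 1 + p * (q + 1) / (p + 1)" and n: "n = DIM('a)"
    and u: "Lp_loc p (Q_dom \<infinity>) u" and v: "Lp_loc q (Q_dom \<infinity>) v"
    and m: "3 \<le> m" "real m \<le> real (m - 2) * q"
    and d: "\<And>T t r. 1 \<le> T \<Longrightarrow> 0 < r \<Longrightarrow> real m \<le> real (m - 2) * r \<Longrightarrow>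
        \<bar>d T t\<bar> \<le> A / T * time_cut m T t powr (1 / r)" "0 < A"
    and G: "0 < G" and F: "0 \<le> F"
    and ineq1: "\<And>T \<epsilon>. 1 \<le> T \<Longrightarrow> 0 < \<epsilon> \<Longrightarrow> \<epsilon> \<le> 1 / 2 \<Longrightarrow>
      int_Q \<infinity> (\<lambda>z. weight \<rho> z * \<bar>u z\<bar> powr p * radial_test m H T \<epsilon> z) + G * T
      \<le> int_Q \<infinity> (\<lambda>z. v z * tensor (d T) (\<lambda>\<tau>. H \<tau> * space_cut m \<epsilon> \<tau>) z)
        - int_Q \<infinity> (\<lambda>z. v z * laplacian (radial_test m H T \<epsilon>) z)"
    and ineq2: "\<And>T \<epsilon>. 1 \<le> T \<Longrightarrow> 0 < \<epsilon> \<Longrightarrow> \<epsilon> \<le> 1 / 2 \<Longrightarrow>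
      int_Q \<infinity> (\<lambda>z. weight \<rho> z * \<bar>v z\<bar> powr q * radial_test m H T \<epsilon> z) + F * T
      \<le> int_Q \<infinity> (\<lambda>z. u z * tensor (d T) (\<lambda>\<tau>. H \<tau> * space_cut m \<epsilon> \<tau>) z)
        - int_Q \<infinity> (\<lambda>z. u z * laplacian (radial_test m H T \<epsilon>) z)"
  shows False
proof -
  have p: "1 < p" using pq by simp
  have mp: "real m \<le> real (m - 2) * p"
    using m(2) pq by (meson mult_left_mono of_nat_0_le_iff order_trans)
  have \<rho>0: "0 \<le> \<rho>" using p pq by (simp add: \<rho>)
  define \<delta> where "\<delta> = (p - q) / (p + 1)"
  have \<delta>: "0 \<le> \<delta>" using pq p by (simp add: \<delta>_def)
  have ex: "\<rho> - 1 - q = \<delta>" "\<rho> - 1 - p = - p * \<delta>"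
    using p by (auto simp: \<rho> \<delta>_def field_simps)
  define J where "J y r T \<epsilon> = int_Q \<infinity> (\<lambda>z. weight \<rho> z * \<bar>y z\<bar> powr r * radial_test m H T \<epsilon> z)"
    for y :: "real \<times> 'a \<Rightarrow> real" and r T \<epsilon>
  define J' where "J' y r T \<epsilon> = int_Q \<infinity> (\<lambda>z. indicator (annulus \<epsilon>) (snd z) *
      (weight \<rho> z * \<bar>y z\<bar> powr r * radial_test m H T \<epsilon> z))"
    for y :: "real \<times> 'a \<Rightarrow> real" and r T \<epsilon>
  have w0: "0 \<le> weight \<rho> z" for z :: "real \<times> 'a" by (simp add: weight_def case_prod_unfold)
  have P0: "0 \<le> weight \<rho> z * \<bar>y z\<bar> powr r * radial_test m H T \<epsilon> z"
    if "z \<in> Q_dom \<infinity>" for y :: "real \<times> 'a \<Rightarrow> real" and r T \<epsilon> z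
    using radial_test_nonneg[OF that] w0 by simp
  have J0: "0 \<le> J y r T \<epsilon>" for y r T \<epsilon>
    unfolding J_def int_Q_def set_lebesgue_integral_def
    by (rule Bochner_Integration.integral_nonneg) (use P0 in \<open>auto simp: indicator_def\<close>)
  have J'J: "J' y r T \<epsilon> \<le> J y r T \<epsilon>" if y: "Lp_loc r (Q_dom \<infinity>) y" and T: "1 \<le> T" "0 < \<epsilon>" for y r T \<epsilon>
    unfolding J_def J'_def int_Q_def set_lebesgue_integral_def
  proof (rule integral_mono')
    show "integrable lebesgue (\<lambda>z. indicator (Q_dom \<infinity>) z *\<^sub>R
        (weight \<rho> z * \<bar>y z\<bar> powr r * radial_test m H T \<epsilon> z))"
      using weighted_integrable[OF y _ T(2) m(1), of T] T by (simp add: set_integrable_def)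
  qed (use P0 in \<open>auto simp: indicator_def\<close>)
  have J'_step: "J' y r T \<epsilon> \<le> J y r T (\<epsilon> / 2) - J y r T (2 * \<epsilon>)"
    if y: "Lp_loc r (Q_dom \<infinity>) y" and T: "1 \<le> T" "0 < \<epsilon>" for y r T \<epsilon>
  proof -
    have i: "integrable lebesgue (\<lambda>z. indicator (Q_dom \<infinity>) z *\<^sub>R
        (weight \<rho> z * \<bar>y z\<bar> powr r * radial_test m H T s z))" if "0 < s" for s
      using weighted_integrable[OF y _ that m(1), of T] T by (simp add: set_integrable_def)
    have step: "indicator (annulus \<epsilon>) (snd z) * (weight \<rho> z * \<bar>y z\<bar> powr r * radial_test m H T \<epsilon> z)
        \<le> weight \<rho> z * \<bar>y z\<bar> powr r * radial_test m H T (\<epsilon> / 2) z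
          - weight \<rho> z * \<bar>y z\<bar> powr r * radial_test m H T (2 * \<epsilon>) z" if z: "z \<in> Q_dom \<infinity>" for z
    proof -
      obtain t x where tx: "z = (t, x)" by (cases z)
      have x: "1 < x \<bullet> x" "x \<bullet> x \<le> 4" using z by (auto simp: tx Q_dom_infinity shell_inner)
      define c where "c = weight \<rho> z * \<bar>y z\<bar> powr r * (time_cut m T t * H (x \<bullet> x))"
      have "0 \<le> c" using w0 time_cut_bounds nonneg[of "x \<bullet> x"] x by (simp add: c_def)
      have "(if 1 + \<epsilon> < x \<bullet> x \<and> x \<bullet> x < 1 + 2 * \<epsilon> then space_cut m \<epsilon> (x \<bullet> x) else 0) =
          indicator (annulus \<epsilon>) x * space_cut m \<epsilon> (x \<bullet> x)"
        by (simp add: annulus_def)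
      from mult_left_mono[OF space_cut_step[OF T(2) m(1), of "x \<bullet> x", unfolded this] \<open>0 \<le> c\<close>]
      show ?thesis
        by (simp add: tx c_def radial_test_def tensor_def algebra_simps)
    qed
    have "J' y r T \<epsilon> \<le> integral\<^sup>L lebesgue (\<lambda>z. indicator (Q_dom \<infinity>) z *\<^sub>R
          (weight \<rho> z * \<bar>y z\<bar> powr r * radial_test m H T (\<epsilon> / 2) z)
        - indicator (Q_dom \<infinity>) z *\<^sub>R (weight \<rho> z * \<bar>y z\<bar> powr r * radial_test m H T (2 * \<epsilon>) z))"
      unfolding J'_def int_Q_def set_lebesgue_integral_def
    proof (rule integral_mono')
      have pos: "0 \<le> indicator (annulus \<epsilon>) (snd z) * (weight \<rho> z * \<bar>y z\<bar> powr r * radial_test m H T \<epsilon> z)"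
        if "z \<in> Q_dom \<infinity>" for z
        using P0[OF that] by (simp add: indicator_def)
      show "0 \<le> indicator (Q_dom \<infinity>) z *\<^sub>R (weight \<rho> z * \<bar>y z\<bar> powr r * radial_test m H T (\<epsilon> / 2) z)
        - indicator (Q_dom \<infinity>) z *\<^sub>R (weight \<rho> z * \<bar>y z\<bar> powr r * radial_test m H T (2 * \<epsilon>) z)" for z
        using order_trans[OF pos step] by (cases "z \<in> Q_dom \<infinity>") auto
      show "integrable lebesgue (\<lambda>z. indicator (Q_dom \<infinity>) z *\<^sub>R
          (weight \<rho> z * \<bar>y z\<bar> powr r * radial_test m H T (\<epsilon> / 2) z)
        - indicator (Q_dom \<infinity>) z *\<^sub>R (weight \<rho> z * \<bar>y z\<bar> powr r * radial_test m H T (2 * \<epsilon>) z))"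
        by (rule Bochner_Integration.integrable_diff[OF i i]) (use T in auto)
    qed (use step in \<open>auto simp: indicator_def\<close>)
    also have "\<dots> = J y r T (\<epsilon> / 2) - J y r T (2 * \<epsilon>)"
      unfolding J_def int_Q_def set_lebesgue_integral_def
      by (rule Bochner_Integration.integral_diff[OF i i]) (use T in auto)
    finally show ?thesis .
  qed
  obtain C where C: "0 < C" and est_v: "\<And>T \<epsilon> l. 1 \<le> T \<Longrightarrow> 0 < \<epsilon> \<Longrightarrow> \<epsilon> \<le> 1 / 2 \<Longrightarrow> 0 < l \<Longrightarrow>
      int_Q \<infinity> (\<lambda>z. v z * tensor (d T) (\<lambda>\<tau>. H \<tau> * space_cut m \<epsilon> \<tau>) z)
        - int_Q \<infinity> (\<lambda>z. v z * laplacian (radial_test m H T \<epsilon>) z)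
      \<le> l * J' v q T \<epsilon> + T * (C * l powr (- 1 / (q - 1)) * \<epsilon> powr ((\<rho> - 1 - q) / (q - 1)))
        + C / T * J v q T \<epsilon> + C"
    unfolding J_def J'_def
    by (rule test_estimate[OF v pq(2) \<rho>0 n m d(1) d(2)]) (use pq m in auto)
  obtain C' where C': "0 < C'" and est_u: "\<And>T \<epsilon> l. 1 \<le> T \<Longrightarrow> 0 < \<epsilon> \<Longrightarrow> \<epsilon> \<le> 1 / 2 \<Longrightarrow> 0 < l \<Longrightarrow>
      int_Q \<infinity> (\<lambda>z. u z * tensor (d T) (\<lambda>\<tau>. H \<tau> * space_cut m \<epsilon> \<tau>) z)
        - int_Q \<infinity> (\<lambda>z. u z * laplacian (radial_test m H T \<epsilon>) z)
      \<le> l * J' u p T \<epsilon> + T * (C' * l powr (- 1 / (p - 1)) * \<epsilon> powr ((\<rho> - 1 - p) / (p - 1)))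
        + C' / T * J u p T \<epsilon> + C'"
    unfolding J_def J'_def
    by (rule test_estimate[OF u p \<rho>0 n m(1) mp d(1) d(2)]) (use p mp in auto)
  \<comment> \<open>Starting at \<open>1 / 2\<close> keeps all layers inside \<open>x \<bullet> x \<le> 2\<close>, away from the outer sphere.\<close>
  define e :: "nat \<Rightarrow> real" where "e k = (1 / 2) ^ Suc k" for k
  have e: "0 < e k" "e k \<le> 1 / 2" for k
    by (auto simp: e_def power_le_one)
  have eS: "e (Suc k) / 2 = e (Suc (Suc k))" "2 * e (Suc k) = e k" for k by (auto simp: e_def)
  show False
  proof (rule critical_iteration[where C = C and C' = C' and G = G and p = p and q = q and \<delta> = \<delta> and e = e
        and a = "\<lambda>T k. J u p T (e k) / T" and b = "\<lambda>T k. J v q T (e k) / T"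
        and D = "\<lambda>T k. J' u p T (e k) / T"])
    fix T l :: real and k :: nat
    assume T: "1 \<le> T"
    show "0 \<le> J u p T (e k) / T" "0 \<le> J v q T (e k) / T" using J0 T by auto
    show "J' u p T (e k) / T \<le> J u p T (e k) / T"
      using J'J[OF u T e(1)] T by (simp add: divide_right_mono)
    show "J' u p T (e (Suc k)) / T \<le> J u p T (e (Suc (Suc k))) / T - J u p T (e k) / T"
      using J'_step[OF u T e(1), of "Suc k"] T
      by (simp add: eS divide_right_mono diff_divide_distrib[symmetric])
    assume l: "0 < l"
    have "J u p T (e k) + G * T \<le> l * J' v q T (e k)
        + T * (C * l powr (- 1 / (q - 1)) * e k powr (\<delta> / (q - 1))) + C / T * J v q T (e k) + C"
      using order_trans[OF ineq1[OF T e] est_v[OF T e l]] by (simp add: J_def ex)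
    also have "l * J' v q T (e k) \<le> l * J v q T (e k)"
      using J'J[OF v T e(1)] l by (intro mult_left_mono) auto
    finally have "(J u p T (e k) + G * T) / T \<le> (l * J v q T (e k)
        + T * (C * l powr (- 1 / (q - 1)) * e k powr (\<delta> / (q - 1))) + C / T * J v q T (e k) + C) / T"
      using T by (intro divide_right_mono) auto
    then show "J u p T (e k) / T + G \<le> l * (J v q T (e k) / T)
        + C * l powr (- 1 / (q - 1)) * e k powr (\<delta> / (q - 1)) + C / T * (J v q T (e k) / T + 1)"
      using T by (simp add: add_divide_distrib distrib_left)
    have "J v q T (e k) \<le> J v q T (e k) + F * T" using F T by simp
    also have "\<dots> \<le> l * J' u p T (e k)
        + T * (C' * l powr (- 1 / (p - 1)) * e k powr (- p * \<delta> / (p - 1))) + C' / T * J u p T (e k) + C'"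
      using order_trans[OF ineq2[OF T e] est_u[OF T e l]] by (simp add: J_def ex)
    finally have "J v q T (e k) / T \<le> (l * J' u p T (e k)
        + T * (C' * l powr (- 1 / (p - 1)) * e k powr (- p * \<delta> / (p - 1))) + C' / T * J u p T (e k) + C') / T"
      using T by (intro divide_right_mono) auto
    then show "J v q T (e k) / T \<le> l * (J' u p T (e k) / T)
        + C' * l powr (- 1 / (p - 1)) * e k powr (- p * \<delta> / (p - 1)) + C' / T * (J u p T (e k) / T + 1)"
      using T by (simp add: add_divide_distrib distrib_left)
  next
    show "e k \<le> 1" for k using e(2)[of k] by linarith
  qed (use C C' G p pq \<delta> e in auto)
qed

end

section \<open>Boundary integrals\<close>

lemma integral_pair_separated:
  fixes a :: "'b \<Rightarrow> real" and b :: "'c \<Rightarrow> real"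
  assumes "sigma_finite_measure M1" "sigma_finite_measure M2"
    and a: "integrable M1 a" and b: "integrable M2 b"
  shows "integral\<^sup>L (M1 \<Otimes>\<^sub>M M2) (\<lambda>z. a (fst z) * b (snd z)) = integral\<^sup>L M1 a * integral\<^sup>L M2 b"
proof -
  interpret pair_sigma_finite M1 M2 using assms by (simp add: pair_sigma_finite_def)
  have [measurable]: "a \<in> borel_measurable M1" "b \<in> borel_measurable M2" using a b by auto
  have "integrable (M1 \<Otimes>\<^sub>M M2) (\<lambda>z. a (fst z) * b (snd z))"
    by (rule Fubini_integrable) (use a b in \<open>auto simp: abs_mult\<close>)
  from integral_fst'[OF this] show ?thesis by simp
qed

lemma time_cut_integral_lower:
  assumes T: "1 \<le> T" and m: "3 \<le> m"
  shows "integrable lborel (time_cut m T)"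
    and "(3 / 16) ^ m / 2 * T \<le> integral\<^sup>L lborel (time_cut m T)"
proof -
  have "continuous_on UNIV (time_cut m T)"
    unfolding time_cut_def[abs_def] using T by (intro continuous_intros) auto
  then have meas: "time_cut m T \<in> borel_measurable borel"
    by (rule borel_measurable_continuous_onI)
  have up: "norm (time_cut m T t) \<le> norm (indicator {T..2 * T} t :: real)" for t
    using time_cut_bounds[of m T t] time_cut_eq_0[of T m t] T m by (auto simp: indicator_def)
  show int: "integrable lborel (time_cut m T)"
    by (rule Bochner_Integration.integrable_bound[of _ "indicator {T..2 * T} :: real \<Rightarrow> real"])
      (use meas up T in \<open>auto intro!: integrable_real_indicator\<close>)
  let ?I = "{5 / 4 * T..7 / 4 * T}"
  have "(3 / 16) ^ m / 2 * T = integral\<^sup>L lborel (\<lambda>t. (3 / 16) ^ m * indicator ?I t :: real)"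
    using T by simp
  also have "\<dots> \<le> integral\<^sup>L lborel (time_cut m T)"
  proof (rule integral_mono'[OF int])
    show "(3 / 16) ^ m * indicator ?I t \<le> time_cut m T t" for t
      using time_cut_lower[of T t m] time_cut_bounds[of m T t] T by (auto simp: indicator_def)
  qed (rule time_cut_bounds)
  finally show "(3 / 16) ^ m / 2 * T \<le> integral\<^sup>L lborel (time_cut m T)" .
qed

text \<open>
  The boundary term separates into the integral of the time cutoff, which grows linearly in \<open>T\<close>,
  and the integral of the boundary datum. The constant \<open>(3 / 16) ^ m / 2\<close> is the value of the
  cutoff at \<open>5 / 4 * T\<close> and \<open>7 / 4 * T\<close> times the length of the interval between, for \<open>T = 1\<close>.
\<close>

lemma int_Gamma_lower:
  fixes h :: "'a::euclidean_space \<Rightarrow> real"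
  assumes h: "set_integrable (sphere_measure 2) (sphere 0 2) h"
      "0 \<le> (LINT x:sphere 0 2|sphere_measure 2. h x)"
    and T: "1 \<le> T" and m: "3 \<le> m" and c: "0 \<le> c"
    and F: "\<And>t x. x \<in> sphere 0 2 \<Longrightarrow> F (t, x) = c * (h x * time_cut m T t)"
  shows "c * ((3 / 16) ^ m / 2) * (LINT x:sphere 0 2|sphere_measure 2. h x) * T \<le> int_Gamma \<infinity> F"
proof -
  let ?b = "\<lambda>x::'a. indicator (sphere 0 2) x *\<^sub>R h x"
  have "int_Gamma \<infinity> F =
      integral\<^sup>L (lborel \<Otimes>\<^sub>M sphere_measure 2) (\<lambda>z. (c * time_cut m T (fst z)) * ?b (snd z))"
    unfolding int_Gamma_def set_lebesgue_integral_def
  proof (rule Bochner_Integration.integral_cong[OF refl])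
    fix z :: "real \<times> 'a"
    show "indicator (Gamma_dom \<infinity>) z *\<^sub>R F z = (c * time_cut m T (fst z)) * ?b (snd z)"
      using F time_cut_eq_0[of T m "fst z"] T m
      by (cases z) (auto simp: Gamma_dom_def indicator_def)
  qed
  also have "\<dots> = integral\<^sup>L lborel (\<lambda>t. c * time_cut m T t) * integral\<^sup>L (sphere_measure 2) ?b"
  proof (rule integral_pair_separated)
    show "sigma_finite_measure (sphere_measure 2 :: 'a measure)"
      using finite_measure_sphere_measure by (rule finite_measure.axioms(1))
    show "sigma_finite_measure (lborel :: real measure)" by (rule sigma_finite_lborel)
    show "integrable lborel (\<lambda>t. c * time_cut m T t)"
      using time_cut_integral_lower(1)[OF T m] by simp
    show "integrable (sphere_measure 2) ?b" using h(1) by (simp add: set_integrable_def)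
  qed
  also have "\<dots> = c * integral\<^sup>L lborel (time_cut m T) * (LINT x:sphere 0 2|sphere_measure 2. h x)"
    by (simp add: set_lebesgue_integral_def)
  also have "\<dots> \<ge> c * ((3 / 16) ^ m / 2 * T) * (LINT x:sphere 0 2|sphere_measure 2. h x)"
    using time_cut_integral_lower(2)[OF T m] c h(2) by (intro mult_right_mono mult_left_mono) auto
  finally show ?thesis by (simp add: mult_ac)
qed

context radial_harmonic
begin

text \<open>
  The boundary and time terms are parameters so that one argument serves all four problems. The time term
  becomes an integral against a function \<open>d T\<close> of time, either minus the first or the second
  derivative of the time cutoff.
\<close>

lemma no_weak_solution_ordered:
  fixes u v :: "real \<times> 'a::euclidean_space \<Rightarrow> real" and f g :: "'a \<Rightarrow> real"
    and time_term :: "(real \<times> 'a \<Rightarrow> real) \<Rightarrow> (real \<times> 'a \<Rightarrow> real) \<Rightarrow> real"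
    and boundary_term :: "(real \<times> 'a \<Rightarrow> real) \<Rightarrow> ('a \<Rightarrow> real) \<Rightarrow> real"
  assumes n: "n = DIM('a)" and pq: "q \<le> p" "1 < q" and \<rho>: "\<rho> = 1 + p * (q + 1) / (p + 1)"
    and u: "Lp_loc p (Q_dom \<infinity>) u" and v: "Lp_loc q (Q_dom \<infinity>) v"
    and f: "set_integrable (sphere_measure 2) (sphere 0 2) f" "(LINT x:sphere 0 2|sphere_measure 2. f x) > 0"
    and g: "set_integrable (sphere_measure 2) (sphere 0 2) g" "(LINT x:sphere 0 2|sphere_measure 2. g x) > 0"
    and time: "time_term = (\<lambda>\<phi> y. - int_Q \<infinity> (\<lambda>z. y z * time_deriv \<phi> z)) \<or>
      time_term = (\<lambda>\<phi> y. int_Q \<infinity> (\<lambda>z. y z * time_deriv2 \<phi> z))"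
    and c: "0 < c" and boundary: "\<And>m T \<epsilon> h. 3 \<le> m \<Longrightarrow> 1 \<le> T \<Longrightarrow> 0 < \<epsilon> \<Longrightarrow> \<epsilon> \<le> 1 / 2 \<Longrightarrow>
      set_integrable (sphere_measure 2) (sphere 0 2) h \<Longrightarrow>
      0 < (LINT x:sphere 0 2|sphere_measure 2. h x) \<Longrightarrow>
      c * ((3 / 16) ^ m / 2) * (LINT x:sphere 0 2|sphere_measure 2. h x) * T
        \<le> boundary_term (radial_test m H T \<epsilon>) h"
    and weak: "\<And>m T \<epsilon> \<phi>. 3 \<le> m \<Longrightarrow> 1 \<le> T \<Longrightarrow> 0 < \<epsilon> \<Longrightarrow> \<epsilon> \<le> 1 / 2 \<Longrightarrow> \<phi> = radial_test m H T \<epsilon> \<Longrightarrow>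
      int_Q \<infinity> (\<lambda>z. weight \<rho> z * \<bar>u z\<bar> powr p * \<phi> z) + boundary_term \<phi> g
        \<le> time_term \<phi> v - int_Q \<infinity> (\<lambda>z. v z * laplacian \<phi> z) \<and>
      int_Q \<infinity> (\<lambda>z. weight \<rho> z * \<bar>v z\<bar> powr q * \<phi> z) + boundary_term \<phi> f
        \<le> time_term \<phi> u - int_Q \<infinity> (\<lambda>z. u z * laplacian \<phi> z)"
  shows False
proof -
  \<comment> \<open>\<open>m \<ge> 2 q / (q - 1)\<close> is equivalent to \<open>m \<le> (m - 2) q\<close>.\<close>
  obtain m0 :: nat where m0: "2 * q / (q - 1) < real m0" using reals_Archimedean2 by blast
  define m where "m = max 3 m0"
  have m: "3 \<le> m" by (simp add: m_def)
  have "2 * q / (q - 1) \<le> real m" using m0 by (simp add: m_def)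
  then have mq: "real m \<le> real (m - 2) * q" using pq m by (simp add: field_simps of_nat_diff)
  obtain a1 a2 where
    a: "\<And>T. 0 < T \<Longrightarrow> C2_triple UNIV (time_cut m T) (a1 T) (a2 T)"
    and ab: "\<And>T t r. 1 \<le> T \<Longrightarrow> 0 < r \<Longrightarrow> real m \<le> real (m - 2) * r \<Longrightarrow>
        \<bar>a1 T t\<bar> \<le> 4 * (real m)\<^sup>2 / T * time_cut m T t powr (1 / r) \<and>
        \<bar>a2 T t\<bar> \<le> 4 * (real m)\<^sup>2 / T * time_cut m T t powr (1 / r)"
    using time_cut_C2[OF m] by metis
  have "\<exists>d. (\<forall>T t r. 1 \<le> T \<longrightarrow> 0 < r \<longrightarrow> real m \<le> real (m - 2) * r \<longrightarrow>
        \<bar>d T t\<bar> \<le> 4 * (real m)\<^sup>2 / T * time_cut m T t powr (1 / r)) \<and>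
      (\<forall>T \<epsilon> y. 1 \<le> T \<longrightarrow> time_term (radial_test m H T \<epsilon>) y =
        int_Q \<infinity> (\<lambda>z. y z * tensor (d T) (\<lambda>\<tau>. H \<tau> * space_cut m \<epsilon> \<tau>) z))"
    using time
  proof
    assume *: "time_term = (\<lambda>\<phi> y. - int_Q \<infinity> (\<lambda>z. y z * time_deriv \<phi> z))"
    have "time_term (radial_test m H T \<epsilon>) y =
        int_Q \<infinity> (\<lambda>z. y z * tensor (\<lambda>t. - a1 T t) (\<lambda>\<tau>. H \<tau> * space_cut m \<epsilon> \<tau>) z)"
      if "1 \<le> T" for T \<epsilon> y
    proof -
      have "time_deriv (radial_test m H T \<epsilon>) z = tensor (a1 T) (\<lambda>\<tau>. H \<tau> * space_cut m \<epsilon> \<tau>) z" for z :: "real \<times> 'a"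
        using that by (cases z) (simp add: radial_test_def time_deriv_tensor(1)[OF a])
      moreover have "tensor (\<lambda>t. - a1 T t) k z = - tensor (a1 T) k z" for k and z :: "real \<times> 'a"
        by (simp add: tensor_def case_prod_unfold)
      ultimately show ?thesis by (simp add: * int_Q_def set_lebesgue_integral_def)
    qed
    then show ?thesis using ab by (intro exI[of _ "\<lambda>T t. - a1 T t"]) auto
  next
    assume *: "time_term = (\<lambda>\<phi> y. int_Q \<infinity> (\<lambda>z. y z * time_deriv2 \<phi> z))"
    have "time_term (radial_test m H T \<epsilon>) y =
        int_Q \<infinity> (\<lambda>z. y z * tensor (a2 T) (\<lambda>\<tau>. H \<tau> * space_cut m \<epsilon> \<tau>) z)"
      if "1 \<le> T" for T \<epsilon> y
    proof -
      have "time_deriv2 (radial_test m H T \<epsilon>) z = tensor (a2 T) (\<lambda>\<tau>. H \<tau> * space_cut m \<epsilon> \<tau>) z" for z :: "real \<times> 'a"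
        using that by (cases z) (simp add: radial_test_def time_deriv_tensor(2)[OF a])
      then show ?thesis by (simp add: *)
    qed
    then show ?thesis using ab by (intro exI[of _ a2]) auto
  qed
  then obtain d where d: "\<And>T t r. 1 \<le> T \<Longrightarrow> 0 < r \<Longrightarrow> real m \<le> real (m - 2) * r \<Longrightarrow>
        \<bar>d T t\<bar> \<le> 4 * (real m)\<^sup>2 / T * time_cut m T t powr (1 / r)"
    and td: "\<And>T \<epsilon> y. 1 \<le> T \<Longrightarrow> time_term (radial_test m H T \<epsilon>) y =
        int_Q \<infinity> (\<lambda>z. y z * tensor (d T) (\<lambda>\<tau>. H \<tau> * space_cut m \<epsilon> \<tau>) z)"
    by blast
  define k where "k = c * ((3 / 16) ^ m / 2)"
  have k: "0 < k" using c by (simp add: k_def)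
  show False
  proof (rule no_critical_pair[OF pq \<rho> n u v m mq d])
    show "0 < 4 * (real m)\<^sup>2" using m by simp
    show "0 < k * (LINT x:sphere 0 2|sphere_measure 2. g x)" using k g by simp
    show "0 \<le> k * (LINT x:sphere 0 2|sphere_measure 2. f x)" using k f by simp
    fix T \<epsilon> :: real assume T: "1 \<le> T" "0 < \<epsilon>" "\<epsilon> \<le> 1 / 2"
    show "int_Q \<infinity> (\<lambda>z. weight \<rho> z * \<bar>u z\<bar> powr p * radial_test m H T \<epsilon> z)
        + k * (LINT x:sphere 0 2|sphere_measure 2. g x) * T
      \<le> int_Q \<infinity> (\<lambda>z. v z * tensor (d T) (\<lambda>\<tau>. H \<tau> * space_cut m \<epsilon> \<tau>) z)
        - int_Q \<infinity> (\<lambda>z. v z * laplacian (radial_test m H T \<epsilon>) z)"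
      using weak[OF m T refl] boundary[OF m T g] by (simp add: td[OF T(1)] k_def)
    show "int_Q \<infinity> (\<lambda>z. weight \<rho> z * \<bar>v z\<bar> powr q * radial_test m H T \<epsilon> z)
        + k * (LINT x:sphere 0 2|sphere_measure 2. f x) * T
      \<le> int_Q \<infinity> (\<lambda>z. u z * tensor (d T) (\<lambda>\<tau>. H \<tau> * space_cut m \<epsilon> \<tau>) z)
        - int_Q \<infinity> (\<lambda>z. u z * laplacian (radial_test m H T \<epsilon>) z)"
      using weak[OF m T refl] boundary[OF m T f] by (simp add: td[OF T(1)] k_def)
  qed
qed

text \<open>
  The two exponents can be ordered since both systems are invariant under exchanging \<open>(u, p, f)\<close>
  with \<open>(v, q, g)\<close>.
\<close>

lemma no_weak_solution:
  fixes u v :: "real \<times> 'a::euclidean_space \<Rightarrow> real" and f g :: "'a \<Rightarrow> real"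
    and time_term :: "(real \<times> 'a \<Rightarrow> real) \<Rightarrow> (real \<times> 'a \<Rightarrow> real) \<Rightarrow> real"
    and boundary_term :: "(real \<times> 'a \<Rightarrow> real) \<Rightarrow> ('a \<Rightarrow> real) \<Rightarrow> real"
  assumes n: "n = DIM('a)" and pq: "1 < p" "1 < q"
    and \<rho>: "\<rho> = (if p \<ge> q then 1 + p * (q + 1) / (p + 1) else 1 + q * (p + 1) / (q + 1))"
    and uv: "Lp_loc p (Q_dom \<infinity>) u" "Lp_loc q (Q_dom \<infinity>) v"
    and f: "set_integrable (sphere_measure 2) (sphere 0 2) f" "(LINT x:sphere 0 2|sphere_measure 2. f x) > 0"
    and g: "set_integrable (sphere_measure 2) (sphere 0 2) g" "(LINT x:sphere 0 2|sphere_measure 2. g x) > 0"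
    and time: "time_term = (\<lambda>\<phi> y. - int_Q \<infinity> (\<lambda>z. y z * time_deriv \<phi> z)) \<or>
      time_term = (\<lambda>\<phi> y. int_Q \<infinity> (\<lambda>z. y z * time_deriv2 \<phi> z))"
    and c: "0 < c" and boundary: "\<And>m T \<epsilon> h. 3 \<le> m \<Longrightarrow> 1 \<le> T \<Longrightarrow> 0 < \<epsilon> \<Longrightarrow> \<epsilon> \<le> 1 / 2 \<Longrightarrow>
      set_integrable (sphere_measure 2) (sphere 0 2) h \<Longrightarrow>
      0 < (LINT x:sphere 0 2|sphere_measure 2. h x) \<Longrightarrow>
      c * ((3 / 16) ^ m / 2) * (LINT x:sphere 0 2|sphere_measure 2. h x) * T
        \<le> boundary_term (radial_test m H T \<epsilon>) h"
    and weak: "\<And>m T \<epsilon> \<phi>. 3 \<le> m \<Longrightarrow> 1 \<le> T \<Longrightarrow> 0 < \<epsilon> \<Longrightarrow> \<epsilon> \<le> 1 / 2 \<Longrightarrow> \<phi> = radial_test m H T \<epsilon> \<Longrightarrow>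
      int_Q \<infinity> (\<lambda>z. weight \<rho> z * \<bar>u z\<bar> powr p * \<phi> z) + boundary_term \<phi> g
        \<le> time_term \<phi> v - int_Q \<infinity> (\<lambda>z. v z * laplacian \<phi> z) \<and>
      int_Q \<infinity> (\<lambda>z. weight \<rho> z * \<bar>v z\<bar> powr q * \<phi> z) + boundary_term \<phi> f
        \<le> time_term \<phi> u - int_Q \<infinity> (\<lambda>z. u z * laplacian \<phi> z)"
  shows False
proof (cases "q \<le> p")
  case True
  with \<rho> have \<rho>': "\<rho> = 1 + p * (q + 1) / (p + 1)" by simp
  show False
    by (rule no_weak_solution_ordered[OF n True pq(2) \<rho>' uv f g time c boundary weak])
next
  case False
  then have "p \<le> q" and \<rho>': "\<rho> = 1 + q * (p + 1) / (q + 1)" using \<rho> by auto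
  show False
    by (rule no_weak_solution_ordered[OF n \<open>p \<le> q\<close> pq(1) \<rho>' uv(2,1) g f time c boundary])
      (use weak in blast)+
qed

end

section \<open>Harmonic profiles and the four problems\<close>

lemma radial_harmonic_one: "radial_harmonic (\<lambda>_. 1) (\<lambda>_. 0) (\<lambda>_. 0) n"
  by unfold_locales (auto intro: C2_triple_const)

text \<open>
  The profile is determined by \<open>H' = - \<tau> powr (- n / 2)\<close>, i.e. it is a decreasing affine function of
  the fundamental solution, written in the squared radius, and therefore logarithmic for \<open>n = 2\<close>.
\<close>

lemma radial_harmonic_dirichlet:
  obtains H H1 H2 where "radial_harmonic H H1 H2 n" "H 4 = 0" "H1 4 < 0"
proof -
  define H1 where "H1 = (\<lambda>\<tau>::real. - (\<tau> powr (- real n / 2)))"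
  define H2 where "H2 = (\<lambda>\<tau>::real. real n / 2 * \<tau> powr (- real n / 2 - 1))"
  obtain H where H: "\<And>\<tau>. 0 < \<tau> \<Longrightarrow> (H has_real_derivative H1 \<tau>) (at \<tau>)" and H4: "H 4 = 0"
  proof (cases "n = 2")
    case True
    show thesis
    proof (rule that[of "\<lambda>\<tau>. ln 4 - ln \<tau>"])
      fix \<tau> :: real assume "0 < \<tau>"
      then show "((\<lambda>\<tau>. ln 4 - ln \<tau>) has_real_derivative H1 \<tau>) (at \<tau>)"
        by (auto intro!: derivative_eq_intros simp: H1_def True powr_minus_divide)
    qed simp
  next
    case False
    define s where "s = 1 - real n / 2"
    have s: "s \<noteq> 0" using False by (simp add: s_def)
    show thesis
    proof (rule that[of "\<lambda>\<tau>. (4 powr s - \<tau> powr s) / s"])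
      fix \<tau> :: real assume "0 < \<tau>"
      then have "((\<lambda>\<tau>. (4 powr s - \<tau> powr s) / s) has_real_derivative - (s * \<tau> powr (s - 1)) / s) (at \<tau>)"
        using s by (auto intro!: derivative_eq_intros)
      then show "((\<lambda>\<tau>. (4 powr s - \<tau> powr s) / s) has_real_derivative H1 \<tau>) (at \<tau>)"
        using s by (simp add: H1_def s_def)
    qed simp
  qed
  have H1': "(H1 has_real_derivative H2 \<tau>) (at \<tau>)" if "0 < \<tau>" for \<tau>
    unfolding H1_def H2_def using that by (auto intro!: derivative_eq_intros)
  have pos: "0 < H \<tau>" if "1 \<le> \<tau>" "\<tau> < 4" for \<tau>
  proof -
    have "H 4 < H \<tau>"
    proof (rule DERIV_neg_imp_decreasing[OF that(2)])
      fix x assume "\<tau> \<le> x" "x \<le> 4"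
      then have "0 < x" using that by simp
      then show "\<exists>y. (H has_real_derivative y) (at x) \<and> y < 0"
        using H[of x] by (intro exI[of _ "H1 x"]) (simp add: H1_def)
    qed
    then show ?thesis using H4 by simp
  qed
  have "radial_harmonic H H1 H2 n"
  proof
    show "C2_triple {0<..} H H1 H2"
      unfolding C2_triple_def using H H1' by (auto simp: H2_def intro!: continuous_intros)
    show "4 * \<tau> * H2 \<tau> + 2 * real n * H1 \<tau> = 0" if "0 < \<tau>" for \<tau>
    proof -
      have "\<tau> * \<tau> powr (- real n / 2 - 1) = \<tau> powr (- real n / 2)"
        using that by (simp add: powr_mult_base)
      then show ?thesis by (simp add: H1_def H2_def mult.left_commute[of \<tau>])
    qed
    show "0 \<le> H \<tau>" if "1 \<le> \<tau>" "\<tau> \<le> 4" for \<tau>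
      using pos[of \<tau>] that H4 by (cases "\<tau> = 4") auto
    show "0 < H \<tau>" if "1 \<le> \<tau>" "\<tau> \<le> 2" for \<tau> using pos[of \<tau>] that by simp
  qed
  moreover have "H1 4 < 0" by (simp add: H1_def)
  ultimately show thesis using that[of H H1 H2] H4 by simp
qed

lemma (in radial_harmonic) radial_test_boundary:
  fixes x :: "'a::euclidean_space"
  assumes "3 \<le> m" "0 < \<epsilon>" "\<epsilon> \<le> 1 / 2" "x \<in> sphere 0 2"
  shows "radial_test m H T \<epsilon> (t, x) = H 4 * time_cut m T t"
    and "normal_deriv (radial_test m H T \<epsilon>) (t, x) = 4 * H1 4 * time_cut m T t"
proof -
  have "x \<bullet> x = 4" using assms(4) by (simp add: power2_norm_eq_inner[symmetric])
  moreover have \<xi>: "space_cut m \<epsilon> 4 = 1" using assms by (intro space_cut_eq_1) auto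
  ultimately show "radial_test m H T \<epsilon> (t, x) = H 4 * time_cut m T t"
    by (simp add: radial_test_def tensor_def)
  obtain b1 b2 where b: "C2_triple UNIV (space_cut m \<epsilon>) b1 b2" and b0: "b1 4 = 0"
  proof (rule space_cut_C2[OF assms(1)])
    fix b1 b2 :: "real \<Rightarrow> real \<Rightarrow> real"
    assume "\<And>\<epsilon>. 0 < \<epsilon> \<Longrightarrow> C2_triple UNIV (space_cut m \<epsilon>) (b1 \<epsilon>) (b2 \<epsilon>)"
      "\<And>\<epsilon> \<tau>. 0 < \<epsilon> \<Longrightarrow> \<not> (1 + \<epsilon> < \<tau> \<and> \<tau> < 1 + 2 * \<epsilon>) \<Longrightarrow> b1 \<epsilon> \<tau> = 0 \<and> b2 \<epsilon> \<tau> = 0"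
    from this(1)[of \<epsilon>] this(2)[of \<epsilon> 4] show thesis
      using assms by (intro that[of "b1 \<epsilon>" "b2 \<epsilon>"]) auto
  qed
  from profile_C2[OF b] have "((\<lambda>\<tau>. H \<tau> * space_cut m \<epsilon> \<tau>) has_real_derivative
      H1 4 * space_cut m \<epsilon> 4 + H 4 * b1 4) (at 4)"
    by (simp add: C2_triple_def)
  then have "((\<lambda>\<tau>. H \<tau> * space_cut m \<epsilon> \<tau>) has_real_derivative H1 4) (at 4)"
    by (simp add: \<xi> b0)
  then show "normal_deriv (radial_test m H T \<epsilon>) (t, x) = 4 * H1 4 * time_cut m T t"
    unfolding radial_test_def
    by (rule normal_deriv_tensor[where ?k1.0 = H1, OF _ assms(4)])
qed

theorem theorem2p10:
  fixes f g :: "real ^ 'n \<Rightarrow> real" and p q \<rho> :: real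
  assumes N: "CARD('n) \<ge> 2"
    and pq: "p > 1" "q > 1"
    and f_L1: "set_integrable (sphere_measure 2) (sphere 0 2) f"
    and g_L1: "set_integrable (sphere_measure 2) (sphere 0 2) g"
    and f_pos: "(LINT x:sphere 0 2|sphere_measure 2. f x) > 0"
    and g_pos: "(LINT x:sphere 0 2|sphere_measure 2. g x) > 0"
    and rho: "\<rho> = (if p \<ge> q then 1 + p * (q + 1) / (p + 1) else 1 + q * (p + 1) / (q + 1))"
  shows "(\<nexists>u v. parabolic_neumann_solution \<infinity> p q \<rho> f g u v) \<and>
         (\<nexists>u v. parabolic_dirichlet_solution \<infinity> p q \<rho> f g u v) \<and>
         (\<nexists>u v. hyperbolic_neumann_solution \<infinity> p q \<rho> f g u v) \<and>
         (\<nexists>u v. hyperbolic_dirichlet_solution \<infinity> p q \<rho> f g u v)"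
proof -
  let ?n = "DIM(real ^ 'n)"
  interpret N: radial_harmonic "\<lambda>_. 1" "\<lambda>_. 0" "\<lambda>_. 0" ?n by (rule radial_harmonic_one)
  obtain H H1 H2 where "radial_harmonic H H1 H2 ?n" and H4: "H 4 = 0" "H1 4 < 0"
    by (rule radial_harmonic_dirichlet)
  then interpret D: radial_harmonic H H1 H2 ?n by simp
  have Gam: "x \<in> sphere 0 2" if "(t, x) \<in> Gamma_dom \<infinity>" for t and x :: "real ^ 'n"
    using that by (simp add: Gamma_dom_def)
  have neumann: "neumann_test \<infinity> (radial_test m (\<lambda>_. 1) T \<epsilon> :: real \<times> (real ^ 'n) \<Rightarrow> real)"
    if "3 \<le> m" "1 \<le> T" "0 < \<epsilon>" "\<epsilon> \<le> 1 / 2" for m T \<epsilon>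
    unfolding neumann_test_def
    using N.radial_test_is_test_function[where 'a = "real ^ 'n", of T \<epsilon> m] N.radial_test_boundary(2)[where 'a = "real ^ 'n" and m = m and \<epsilon> = \<epsilon>] that Gam by auto
  have dirichlet: "dirichlet_test \<infinity> (radial_test m H T \<epsilon> :: real \<times> (real ^ 'n) \<Rightarrow> real)"
    if "3 \<le> m" "1 \<le> T" "0 < \<epsilon>" "\<epsilon> \<le> 1 / 2" for m T \<epsilon>
    unfolding dirichlet_test_def
    using D.radial_test_is_test_function[where 'a = "real ^ 'n", of T \<epsilon> m] D.radial_test_boundary[where 'a = "real ^ 'n" and m = m and \<epsilon> = \<epsilon>] that Gam
      H4 time_cut_bounds[of m T] by (auto simp: mult_nonpos_nonneg)
  let ?I = "\<lambda>h. (LINT x:sphere 0 2|sphere_measure 2. h x) :: real"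
  have bd_neumann: "1 * ((3 / 16) ^ m / 2) * ?I h * T
      \<le> int_Gamma \<infinity> (\<lambda>z. h (snd z) * radial_test m (\<lambda>_. 1) T \<epsilon> z)"
    if "3 \<le> m" "1 \<le> T" "0 < \<epsilon>" "\<epsilon> \<le> 1 / 2" "set_integrable (sphere_measure 2) (sphere 0 2) h" "0 < ?I h"
    for m T \<epsilon> and h :: "real ^ 'n \<Rightarrow> real"
    by (rule int_Gamma_lower) (use that N.radial_test_boundary(1)[where 'a = "real ^ 'n" and m = m and \<epsilon> = \<epsilon>] in auto)
  have bd_dirichlet: "(- 4 * H1 4) * ((3 / 16) ^ m / 2) * ?I h * T
      \<le> - int_Gamma \<infinity> (\<lambda>z. h (snd z) * normal_deriv (radial_test m H T \<epsilon>) z)"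
    if "3 \<le> m" "1 \<le> T" "0 < \<epsilon>" "\<epsilon> \<le> 1 / 2" "set_integrable (sphere_measure 2) (sphere 0 2) h" "0 < ?I h"
    for m T \<epsilon> and h :: "real ^ 'n \<Rightarrow> real"
  proof -
    have "(- 4 * H1 4) * ((3 / 16) ^ m / 2) * ?I h * T
        \<le> int_Gamma \<infinity> (\<lambda>z. - (h (snd z) * normal_deriv (radial_test m H T \<epsilon>) z))"
      by (rule int_Gamma_lower) (use that D.radial_test_boundary(2)[where 'a = "real ^ 'n" and m = m and \<epsilon> = \<epsilon>] H4 in auto)
    then show ?thesis by (simp add: int_Gamma_def set_lebesgue_integral_def)
  qed
  note neumann_contra = N.no_weak_solution[OF refl pq rho _ _ f_L1 f_pos g_L1 g_pos _ zero_less_one,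
      where boundary_term = "\<lambda>\<phi> h. int_Gamma \<infinity> (\<lambda>z. h (snd z) * \<phi> z)", OF _ _ _ bd_neumann]
  have "0 < - 4 * H1 4" using H4 by simp
  note dirichlet_contra = D.no_weak_solution[OF refl pq rho _ _ f_L1 f_pos g_L1 g_pos _ this,
      where boundary_term = "\<lambda>\<phi> h. - int_Gamma \<infinity> (\<lambda>z. h (snd z) * normal_deriv \<phi> z)",
      OF _ _ _ bd_dirichlet]
  have "\<not> parabolic_neumann_solution \<infinity> p q \<rho> f g u v" for u v
  proof
    assume sol: "parabolic_neumann_solution \<infinity> p q \<rho> f g u v"
    show False
      by (rule neumann_contra[where u = u and v = v
            and time_term = "\<lambda>\<phi> y. - int_Q \<infinity> (\<lambda>z. y z * time_deriv \<phi> z)"])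
        (use sol neumann in \<open>auto simp: parabolic_neumann_solution_def\<close>)
  qed
  moreover have "\<not> hyperbolic_neumann_solution \<infinity> p q \<rho> f g u v" for u v
  proof
    assume sol: "hyperbolic_neumann_solution \<infinity> p q \<rho> f g u v"
    show False
      by (rule neumann_contra[where u = u and v = v
            and time_term = "\<lambda>\<phi> y. int_Q \<infinity> (\<lambda>z. y z * time_deriv2 \<phi> z)"])
        (use sol neumann in \<open>auto simp: hyperbolic_neumann_solution_def\<close>)
  qed
  moreover have "\<not> parabolic_dirichlet_solution \<infinity> p q \<rho> f g u v" for u v
  proof
    assume sol: "parabolic_dirichlet_solution \<infinity> p q \<rho> f g u v"
    show False
      by (rule dirichlet_contra[where u = u and v = v
            and time_term = "\<lambda>\<phi> y. - int_Q \<infinity> (\<lambda>z. y z * time_deriv \<phi> z)"])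
        (use sol dirichlet in \<open>auto simp: parabolic_dirichlet_solution_def\<close>)
  qed
  moreover have "\<not> hyperbolic_dirichlet_solution \<infinity> p q \<rho> f g u v" for u v
  proof
    assume sol: "hyperbolic_dirichlet_solution \<infinity> p q \<rho> f g u v"
    show False
      by (rule dirichlet_contra[where u = u and v = v
            and time_term = "\<lambda>\<phi> y. int_Q \<infinity> (\<lambda>z. y z * time_deriv2 \<phi> z)"])
        (use sol dirichlet in \<open>auto simp: hyperbolic_dirichlet_solution_def\<close>)
  qed
  ultimately show ?thesis by blast
qed

end
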